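(* Let $p$ be a prime and let $m\ge 1$ be a fixed integer. Then the functions $$\theta_{\gamma s a}^{(m)}(x)=p^{-\gamma/2}\,\chi_p\big(s(p^{\gamma}x-a)\big)\,\Omega\big(|p^{\gamma}x-a|_p\big),\qquad x\in\mathbb{Q}_p,$$ indexed by $\gamma\in\mathbb{Z}$, $s\in J_{p;m}$, $a\in I_p$, form an orthonormal complete basis (i.e. an orthonormal Hilbert-space basis) of $L^2(\mathbb{Q}_p)$.
   Context: $|\cdot|_p$ is the $p$-adic norm on $\mathbb{Q}_p$. $L^2(\mathbb{Q}_p)$ is the space of complex-valued square-integrable functions on $\mathbb{Q}_p$ with respect to the Haar measure $dx$ normalized so that $\mathbb{Z}_p$ has measure $1$. $\chi_p(x)=e^{2\pi i\{x\}_p}$ for $x\in\mathbb{Q}_p$, where $\{x\}_p$ is the fractional part: $\{x\}_p=0$ if $x\in\mathbb{Z}_p$, and $\{x\}_p=p^{\gamma}(x_0+x_1p+\cdots+x_{|\gamma|-1}p^{|\gamma|-1})$ if $x=p^{\gamma}(x_0+x_1p+x_2p^2+\cdots)$ with $\gamma<0$, $0\le x_j\le p-1$, $x_0\neq 0$. $\Omega(t)=1$ for $0\le t\le 1$ and $\Omega(t)=0$ for $t>1$. $I_p=\{p^{-k}(a_0+a_1p+\cdots+a_{k-1}p^{k-1}) : k\in\mathbb{N},\ a_j\in\{0,1,\dots,p-1\}\}\subset\mathbb{Q}_p$ (a set of representatives of $\mathbb{Q}_p/\mathbb{Z}_p$; $\mathbb{N}$ is the set of positive integers). $J_{p;m}=\{p^{-m}(s_0+s_1p+\cdots+s_{m-1}p^{m-1})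 : s_j\in\{0,1,\dots,p-1\},\ s_0\neq 0\}\subset\mathbb{Q}_p$. *)

theory Defs
  imports "HOL-Analysis.Analysis" "Berlekamp_Zassenhaus.Finite_Field"
begin

section \<open>The \<open>p\<close>-adic absolute value on the rationals\<close>

definition padic_val :: "nat \<Rightarrow> rat \<Rightarrow> int" where
  "padic_val p q = int (multiplicity (int p) (fst (quotient_of q)))
                 - int (multiplicity (int p) (snd (quotient_of q)))"

definition padic_abs :: "nat \<Rightarrow> rat \<Rightarrow> real" where
  "padic_abs p q = (if q = 0 then 0 else real p powi (- padic_val p q))"

lemma padic_val_Fract:
  assumes p: "prime p" and a: "a \<noteq> 0" and b: "b \<noteq> 0"
  shows "padic_val p (Rat.Fract a b) = int (multiplicity (int p) a) - int (multiplicity (int p) b)"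
proof -
  obtain c d where cd: "quotient_of (Rat.Fract a b) = (c, d)"
    by (cases "quotient_of (Rat.Fract a b)")
  have d: "d > 0" and eq: "Rat.Fract a b = Rat.Fract c d"
    using quotient_of_denom_pos[OF cd] quotient_of_div[OF cd] by (auto simp: Fract_of_int_quotient)
  have "a * d = c * b" using eq b d by (simp add: eq_rat)
  moreover from this have c: "c \<noteq> 0" using a d by auto
  moreover have pe: "prime_elem (int p)" using p by simp
  ultimately have "multiplicity (int p) a + multiplicity (int p) d
      = multiplicity (int p) c + multiplicity (int p) b"
    using prime_elem_multiplicity_mult_distrib[OF pe] a b d by (metis less_irrefl)
  then show ?thesis unfolding padic_val_def cd by simp
qed

lemma Fract_eq_0_iff: "b \<noteq> 0 \<Longrightarrow> Rat.Fract a b = 0 \<longleftrightarrow> a = 0"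
  by (simp add: Zero_rat_def eq_rat)

lemma padic_abs_0 [simp]: "padic_abs p 0 = 0"
  by (simp add: padic_abs_def)

lemma padic_abs_nonneg [simp]: "0 \<le> padic_abs p q"
  by (simp add: padic_abs_def)

lemma padic_abs_eq_0_iff [simp]: "prime p \<Longrightarrow> padic_abs p q = 0 \<longleftrightarrow> q = 0"
  by (auto simp: padic_abs_def prime_gt_0_nat)

lemma padic_abs_pos_iff: "prime p \<Longrightarrow> 0 < padic_abs p q \<longleftrightarrow> q \<noteq> 0"
  using padic_abs_eq_0_iff[of p q] padic_abs_nonneg[of p q] by linarith

lemma padic_abs_1 [simp]: "prime p \<Longrightarrow> padic_abs p 1 = 1"
  using padic_val_Fract[of p 1 1] by (simp add: padic_abs_def flip: One_rat_def)

lemma padic_abs_mult: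
  assumes p: "prime p"
  shows "padic_abs p (q * r) = padic_abs p q * padic_abs p r"
proof (cases "q = 0 \<or> r = 0")
  case False
  obtain a b where q: "q = Rat.Fract a b" "b > 0" by (cases q)
  obtain c d where r: "r = Rat.Fract c d" "d > 0" by (cases r)
  have nz: "a \<noteq> 0" "c \<noteq> 0" using False q r by (auto simp: rat_number_collapse)
  have pe: "prime_elem (int p)" using p by simp
  have "padic_val p (q * r) = padic_val p q + padic_val p r"
    using nz q r p by (simp add: padic_val_Fract prime_elem_multiplicity_mult_distrib[OF pe])
  then show ?thesis
    using False p by (simp add: padic_abs_def prime_gt_0_nat flip: power_int_add)
qed auto

lemma padic_abs_minus: "prime p \<Longrightarrow> padic_abs p (- q) = padic_abs p q"
proof -
  assume p: "prime p"
  obtain a b where q: "q = Rat.Fract a b" "b > 0" by (cases q)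
  have m: "multiplicity (int p) (- a) = multiplicity (int p) a"
    using multiplicity_times_unit_right[of "- 1" "int p" a] by simp
  show ?thesis
    using q p by (auto simp: padic_abs_def padic_val_Fract Fract_eq_0_iff m)
qed

lemma padic_abs_minus_commute: "prime p \<Longrightarrow> padic_abs p (q - r) = padic_abs p (r - q)"
  using padic_abs_minus[of p "q - r"] by simp

lemma padic_abs_inverse: "prime p \<Longrightarrow> padic_abs p (inverse q) = inverse (padic_abs p q)"
  using padic_abs_mult[of p q "inverse q"]
  by (cases "q = 0") (auto simp: field_simps)

lemma padic_abs_ultrametric:
  assumes p: "prime p"
  shows "padic_abs p (q + r) \<le> max (padic_abs p q) (padic_abs p r)"
proof (cases "q = 0 \<or> r = 0 \<or> q + r = 0")
  case False
  obtain a b where q: "q = Rat.Fract a b" "b > 0" by (cases q)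
  obtain c d where r: "r = Rat.Fract c d" "d > 0" by (cases r)
  let ?v = "multiplicity (int p)"
  let ?x = "a * d" and ?y = "c * b" and ?n = "b * d"
  have n: "?n \<noteq> 0" using q r by auto
  have eqs: "q = Rat.Fract ?x ?n" "r = Rat.Fract ?y ?n" "q + r = Rat.Fract (?x + ?y) ?n"
    using q r by (simp_all add: eq_rat)
  have nz: "?x \<noteq> 0" "?y \<noteq> 0"
    using False n unfolding eqs(1,2) by (simp_all add: Fract_eq_0_iff)
  have nz3: "?x + ?y \<noteq> 0"
    using False n unfolding eqs(3) by (simp add: Fract_eq_0_iff)
  have v: "padic_val p q = int (?v ?x) - int (?v ?n)" "padic_val p r = int (?v ?y) - int (?v ?n)"
    "padic_val p (q + r) = int (?v (?x + ?y)) - int (?v ?n)"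
    unfolding eqs(3) unfolding eqs(1,2)
    by (rule padic_val_Fract[OF p nz(1) n] padic_val_Fract[OF p nz(2) n]
        padic_val_Fract[OF p nz3 n])+
  have "int p ^ min (?v ?x) (?v ?y) dvd ?x + ?y"
    by (intro dvd_add multiplicity_dvd') auto
  then have "min (?v ?x) (?v ?y) \<le> ?v (?x + ?y)"
    using nz3 p by (intro multiplicity_geI) auto
  then have "min (padic_val p q) (padic_val p r) \<le> padic_val p (q + r)"
    unfolding v by linarith
  moreover have "real p powi (- i) \<le> real p powi (- j)" if "j \<le> i" for i j
    using that p by (intro power_int_increasing) (use prime_ge_1_nat[of p] in auto)
  ultimately show ?thesis
    using False by (auto simp: padic_abs_def le_max_iff_disj min_le_iff_disj)
qed (use p in \<open>auto simp: le_max_iff_disj\<close>)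

lemma padic_abs_triangle:
  assumes p: "prime p"
  shows "padic_abs p (q + r) \<le> padic_abs p q + padic_abs p r"
  using padic_abs_ultrametric[OF p, of q r] padic_abs_nonneg[of p q] padic_abs_nonneg[of p r]
  by linarith

lemma padic_abs_triangle_diff:
  assumes p: "prime p"
  shows "\<bar>padic_abs p q - padic_abs p r\<bar> \<le> padic_abs p (q - r)"
  using padic_abs_triangle[OF p, of "q - r" r] padic_abs_triangle[OF p, of "r - q" q]
    padic_abs_minus_commute[OF p, of q r] by simp


section \<open>Cauchy and null sequences for the \<open>p\<close>-adic absolute value\<close>

definition padic_null :: "nat \<Rightarrow> (nat \<Rightarrow> rat) \<Rightarrow> bool" where
  "padic_null p X \<longleftrightarrow> (\<lambda>n. padic_abs p (X n)) \<longlonglongrightarrow> 0"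

definition padic_cauchy :: "nat \<Rightarrow> (nat \<Rightarrow> rat) \<Rightarrow> bool" where
  "padic_cauchy p X \<longleftrightarrow> (\<forall>e>0. \<exists>k. \<forall>m\<ge>k. \<forall>n\<ge>k. padic_abs p (X m - X n) < e)"

lemma padic_nullI:
  assumes "\<And>n. padic_abs p (X n) \<le> f n" "f \<longlonglongrightarrow> 0"
  shows "padic_null p X"
  unfolding padic_null_def
  by (rule tendsto_sandwich[OF _ _ tendsto_const assms(2)]) (use assms(1) in auto)

lemma padic_null_0 [simp]: "padic_null p (\<lambda>n. 0)"
  by (simp add: padic_null_def)

lemma padic_null_minus: "prime p \<Longrightarrow> padic_null p X \<Longrightarrow> padic_null p (\<lambda>n. - X n)"
  by (simp add: padic_null_def padic_abs_minus)

lemma padic_null_add: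
  assumes p: "prime p" and "padic_null p X" "padic_null p Y"
  shows "padic_null p (\<lambda>n. X n + Y n)"
  using assms(2,3) padic_abs_triangle[OF p]
  by (intro padic_nullI[where f = "\<lambda>n. padic_abs p (X n) + padic_abs p (Y n)"])
     (auto simp: padic_null_def intro!: tendsto_add_zero)

lemma padic_cauchyI:
  assumes p: "prime p"
    and "\<And>e. e > 0 \<Longrightarrow> \<exists>k. \<forall>m\<ge>k. \<forall>n\<ge>k. padic_abs p (X m - X n) < e"
  shows "padic_cauchy p X"
  using assms(2) by (simp add: padic_cauchy_def)

lemma padic_cauchyD:
  assumes "padic_cauchy p X" "e > 0"
  obtains k where "\<And>m n. m \<ge> k \<Longrightarrow> n \<ge> k \<Longrightarrow> padic_abs p (X m - X n) < e"
  using assms unfolding padic_cauchy_def by blast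

lemma padic_cauchy_const [simp]: "padic_cauchy p (\<lambda>n. c)"
  by (simp add: padic_cauchy_def)

lemma padic_cauchy_minus:
  assumes "prime p" "padic_cauchy p X"
  shows "padic_cauchy p (\<lambda>n. - X n)"
proof -
  have "padic_abs p (- X m - - X n) = padic_abs p (X m - X n)" for m n
    using padic_abs_minus[OF assms(1), of "X m - X n"] by simp
  then show ?thesis using assms(2) by (simp add: padic_cauchy_def)
qed

lemma padic_cauchy_add:
  assumes p: "prime p" and X: "padic_cauchy p X" and Y: "padic_cauchy p Y"
  shows "padic_cauchy p (\<lambda>n. X n + Y n)"
proof (rule padic_cauchyI[OF p])
  fix e :: real assume e: "e > 0"
  obtain k where k: "\<And>m n. m \<ge> k \<Longrightarrow> n \<ge> k \<Longrightarrow> padic_abs p (X m - X n) < e"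
    using padic_cauchyD[OF X e] by blast
  obtain l where l: "\<And>m n. m \<ge> l \<Longrightarrow> n \<ge> l \<Longrightarrow> padic_abs p (Y m - Y n) < e"
    using padic_cauchyD[OF Y e] by blast
  have "padic_abs p (X m + Y m - (X n + Y n)) < e" if "m \<ge> max k l" "n \<ge> max k l" for m n
    using padic_abs_ultrametric[OF p, of "X m - X n" "Y m - Y n"] k[of m n] l[of m n] that
    by (auto simp: algebra_simps)
  then show "\<exists>j. \<forall>m\<ge>j. \<forall>n\<ge>j. padic_abs p (X m + Y m - (X n + Y n)) < e" by blast
qed

lemma padic_cauchy_abs_convergent:
  assumes p: "prime p" and X: "padic_cauchy p X"
  shows "convergent (\<lambda>n. padic_abs p (X n))"
proof -
  have "Cauchy (\<lambda>n. padic_abs p (X n))"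
  proof (rule metric_CauchyI)
    fix e :: real assume "e > 0"
    then obtain k where "\<And>m n. m \<ge> k \<Longrightarrow> n \<ge> k \<Longrightarrow> padic_abs p (X m - X n) < e"
      using padic_cauchyD[OF X] by blast
    then show "\<exists>M. \<forall>m\<ge>M. \<forall>n\<ge>M. dist (padic_abs p (X m)) (padic_abs p (X n)) < e"
      unfolding dist_real_def using padic_abs_triangle_diff[OF p] by (meson le_less_trans)
  qed
  then show ?thesis by (rule Cauchy_convergent)
qed

lemma padic_cauchy_bounded:
  assumes p: "prime p" and X: "padic_cauchy p X"
  obtains b where "b > 0" "\<And>n. padic_abs p (X n) \<le> b"
proof -
  have "Bseq (\<lambda>n. padic_abs p (X n))"
    using padic_cauchy_abs_convergent[OF assms] by (rule convergent_imp_Bseq)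
  then show thesis using that by (auto simp: Bseq_def)
qed

lemma padic_null_mult:
  assumes p: "prime p" and X: "padic_cauchy p X" and Y: "padic_null p Y"
  shows "padic_null p (\<lambda>n. X n * Y n)"
proof -
  obtain b where b: "b > 0" "\<And>n. padic_abs p (X n) \<le> b"
    using padic_cauchy_bounded[OF p X] by blast
  show ?thesis
    using Y b p
    by (intro padic_nullI[where f = "\<lambda>n. b * padic_abs p (Y n)"])
       (auto simp: padic_null_def padic_abs_mult intro!: mult_right_mono tendsto_mult_right_zero)
qed

lemma padic_cauchy_mult:
  assumes p: "prime p" and X: "padic_cauchy p X" and Y: "padic_cauchy p Y"
  shows "padic_cauchy p (\<lambda>n. X n * Y n)"
proof (rule padic_cauchyI[OF p])
  fix e :: real assume e: "e > 0"
  obtain a where a: "a > 0" "\<And>n. padic_abs p (X n) \<le> a"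
    using padic_cauchy_bounded[OF p X] by blast
  obtain b where b: "b > 0" "\<And>n. padic_abs p (Y n) \<le> b"
    using padic_cauchy_bounded[OF p Y] by blast
  obtain k where k: "\<And>m n. m \<ge> k \<Longrightarrow> n \<ge> k \<Longrightarrow> padic_abs p (X m - X n) < e / b"
    using padic_cauchyD[OF X, of "e / b"] e b by auto
  obtain l where l: "\<And>m n. m \<ge> l \<Longrightarrow> n \<ge> l \<Longrightarrow> padic_abs p (Y m - Y n) < e / a"
    using padic_cauchyD[OF Y, of "e / a"] e a by auto
  have "padic_abs p (X m * Y m - X n * Y n) < e" if "m \<ge> max k l" "n \<ge> max k l" for m n
  proof -
    have "padic_abs p (X m * (Y m - Y n)) \<le> a * padic_abs p (Y m - Y n)"
      using a p by (simp add: padic_abs_mult mult_right_mono)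
    also have "\<dots> < e" using l[of m n] that a by (simp add: field_simps)
    finally have 1: "padic_abs p (X m * (Y m - Y n)) < e" .
    have "padic_abs p ((X m - X n) * Y n) \<le> padic_abs p (X m - X n) * b"
      using b p by (simp add: padic_abs_mult mult_left_mono)
    also have "\<dots> < e" using k[of m n] that b by (simp add: field_simps)
    finally have 2: "padic_abs p ((X m - X n) * Y n) < e" .
    have "X m * Y m - X n * Y n = X m * (Y m - Y n) + (X m - X n) * Y n"
      by (simp add: algebra_simps)
    then show ?thesis
      using padic_abs_ultrametric[OF p, of "X m * (Y m - Y n)" "(X m - X n) * Y n"] 1 2 by simp
  qed
  then show "\<exists>j. \<forall>m\<ge>j. \<forall>n\<ge>j. padic_abs p (X m * Y m - X n * Y n) < e" by blast
qed

lemma padic_cauchy_not_null: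
  assumes p: "prime p" and X: "padic_cauchy p X" and nz: "\<not> padic_null p X"
  shows "\<exists>b>0. \<exists>k. \<forall>n\<ge>k. b < padic_abs p (X n)"
proof -
  obtain L where L: "(\<lambda>n. padic_abs p (X n)) \<longlonglongrightarrow> L"
    using padic_cauchy_abs_convergent[OF p X] by (auto simp: convergent_def)
  have "L \<ge> 0" using L by (rule LIMSEQ_le_const) auto
  moreover have "L \<noteq> 0" using nz L by (auto simp: padic_null_def)
  ultimately have "L / 2 > 0" "L / 2 < L" by auto
  then obtain k where "\<And>n. n \<ge> k \<Longrightarrow> L / 2 < padic_abs p (X n)"
    using order_tendstoD(1)[OF L, of "L / 2"] unfolding eventually_sequentially by blast
  with \<open>L / 2 > 0\<close> show ?thesis by blast
qed

lemma padic_abs_inverse_diff: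
  assumes p: "prime p" and "b > 0" "b < padic_abs p x" "b < padic_abs p y"
  shows "padic_abs p (inverse x - inverse y) \<le> padic_abs p (x - y) / (b * b)"
proof -
  have nz: "x \<noteq> 0" "y \<noteq> 0" using assms by auto
  have "inverse x - inverse y = (y - x) * inverse (x * y)"
    using nz by (simp add: field_simps)
  then have "padic_abs p (inverse x - inverse y)
      = padic_abs p (x - y) / (padic_abs p x * padic_abs p y)"
    using p padic_abs_minus_commute[OF p, of x y]
    by (simp add: padic_abs_mult padic_abs_inverse divide_inverse)
  also have "\<dots> \<le> padic_abs p (x - y) / (b * b)"
    using assms by (intro divide_left_mono mult_mono mult_pos_pos) auto
  finally show ?thesis .
qed

lemma padic_cauchy_inverse:
  assumes p: "prime p" and X: "padic_cauchy p X" and nz: "\<not> padic_null p X"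
  shows "padic_cauchy p (\<lambda>n. inverse (X n))"
proof (rule padic_cauchyI[OF p])
  fix e :: real assume e: "e > 0"
  obtain b k where b: "b > 0" "\<And>n. n \<ge> k \<Longrightarrow> b < padic_abs p (X n)"
    using padic_cauchy_not_null[OF assms] by blast
  obtain l where l: "\<And>m n. m \<ge> l \<Longrightarrow> n \<ge> l \<Longrightarrow> padic_abs p (X m - X n) < e * (b * b)"
    using padic_cauchyD[OF X, of "e * (b * b)"] e b by auto
  have "padic_abs p (inverse (X m) - inverse (X n)) < e"
    if "m \<ge> max k l" "n \<ge> max k l" for m n
  proof -
    have "padic_abs p (inverse (X m) - inverse (X n)) \<le> padic_abs p (X m - X n) / (b * b)"
      using padic_abs_inverse_diff[OF p b(1) b(2)[of m] b(2)[of n]] that by auto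
    also have "\<dots> < e" using l[of m n] that b(1) by (simp add: field_simps)
    finally show ?thesis .
  qed
  then show "\<exists>j. \<forall>m\<ge>j. \<forall>n\<ge>j. padic_abs p (inverse (X m) - inverse (X n)) < e" by blast
qed

lemma padic_null_inverse_diff:
  assumes p: "prime p" and X: "padic_cauchy p X" "\<not> padic_null p X"
    and Y: "padic_cauchy p Y" "\<not> padic_null p Y" and XY: "padic_null p (\<lambda>n. X n - Y n)"
  shows "padic_null p (\<lambda>n. inverse (X n) - inverse (Y n))"
proof -
  obtain a k where a: "a > 0" "\<And>n. n \<ge> k \<Longrightarrow> a < padic_abs p (X n)"
    using padic_cauchy_not_null[OF p X] by blast
  obtain b l where b: "b > 0" "\<And>n. n \<ge> l \<Longrightarrow> b < padic_abs p (Y n)"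
    using padic_cauchy_not_null[OF p Y] by blast
  define c where "c = min a b"
  have c: "c > 0" using a b by (simp add: c_def)
  have "eventually (\<lambda>n. padic_abs p (inverse (X n) - inverse (Y n))
      \<le> padic_abs p (X n - Y n) / (c * c)) sequentially"
    using eventually_ge_at_top[of "max k l"]
  proof eventually_elim
    case (elim n)
    show ?case
      using a(2)[of n] b(2)[of n] elim
      by (intro padic_abs_inverse_diff[OF p c]) (simp_all add: c_def)
  qed
  moreover have "(\<lambda>n. padic_abs p (X n - Y n) / (c * c)) \<longlonglongrightarrow> 0"
    using XY unfolding padic_null_def by (rule tendsto_divide_zero)
  ultimately show ?thesis
    unfolding padic_null_def
    by (rule tendsto_sandwich[OF always_eventually _ tendsto_const, rotated]) simp
qed


section \<open>The field of \<open>p\<close>-adic numbers\<close>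

text \<open>
  The completion of the rationals with respect to the \<open>p\<close>-adic absolute value: the ring of
  \<open>p\<close>-adic Cauchy sequences modulo the ideal of null sequences.  The prime \<open>p\<close> is carried by the
  type argument, as the cardinality of a type of class \<open>prime_card\<close>.
\<close>

typedef 'p padic_seq = "{X. padic_cauchy CARD('p::prime_card) X}"
  by (rule exI[of _ "\<lambda>n. 0"]) simp

setup_lifting type_definition_padic_seq

instantiation padic_seq :: (prime_card) comm_ring_1
begin

lift_definition zero_padic_seq :: "'a padic_seq" is "\<lambda>n. 0"
  by simp

lift_definition one_padic_seq :: "'a padic_seq" is "\<lambda>n. 1"
  by simp

lift_definition plus_padic_seq :: "'a padic_seq \<Rightarrow> 'a padic_seq \<Rightarrow> 'a padic_seq"
  is "\<lambda>X Y n. X n + Y n"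
  by (rule padic_cauchy_add[OF prime_card])

lift_definition uminus_padic_seq :: "'a padic_seq \<Rightarrow> 'a padic_seq" is "\<lambda>X n. - X n"
  by (rule padic_cauchy_minus[OF prime_card])

lift_definition minus_padic_seq :: "'a padic_seq \<Rightarrow> 'a padic_seq \<Rightarrow> 'a padic_seq"
  is "\<lambda>X Y n. X n - Y n"
  using padic_cauchy_add[OF prime_card] padic_cauchy_minus[OF prime_card]
  unfolding diff_conv_add_uminus by blast

lift_definition times_padic_seq :: "'a padic_seq \<Rightarrow> 'a padic_seq \<Rightarrow> 'a padic_seq"
  is "\<lambda>X Y n. X n * Y n"
  by (rule padic_cauchy_mult[OF prime_card])

instance
  by (standard; transfer) (auto simp: algebra_simps fun_eq_iff)

end

lift_definition null_seq :: "'p::prime_card padic_seq \<Rightarrow> bool" is "padic_null CARD('p)" .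

lift_definition inverse_seq :: "'p::prime_card padic_seq \<Rightarrow> 'p padic_seq"
  is "\<lambda>X. if padic_null CARD('p) X then (\<lambda>n. 0) else (\<lambda>n. inverse (X n))"
  by (auto intro: padic_cauchy_inverse[OF prime_card])

lift_definition norm_seq :: "'p::prime_card padic_seq \<Rightarrow> real"
  is "\<lambda>X. lim (\<lambda>n. padic_abs CARD('p) (X n))" .

lemma null_seq_0 [simp]: "null_seq 0"
  by transfer simp

lemma null_seq_minus: "null_seq X \<Longrightarrow> null_seq (- X)"
  by transfer (rule padic_null_minus[OF prime_card])

lemma null_seq_add: "null_seq X \<Longrightarrow> null_seq Y \<Longrightarrow> null_seq (X + Y)"
  by transfer (rule padic_null_add[OF prime_card])

lemma null_seq_mult: "null_seq Y \<Longrightarrow> null_seq (X * Y)"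
  by transfer (rule padic_null_mult[OF prime_card])

lemma null_seq_diff_commute: "null_seq (X - Y) \<Longrightarrow> null_seq (Y - X)"
  using null_seq_minus[of "X - Y"] by simp

lemma null_seq_cong: "null_seq (X - Y) \<Longrightarrow> null_seq X \<longleftrightarrow> null_seq Y"
  using null_seq_add[of "X - Y" Y] null_seq_add[of "Y - X" X] null_seq_diff_commute[of X Y] by auto

lemma not_null_seq_1: "\<not> null_seq 1"
  by transfer (simp add: padic_null_def prime_card LIMSEQ_const_iff)

lemma inverse_seq_cong: "null_seq (X - Y) \<Longrightarrow> null_seq (inverse_seq X - inverse_seq Y)"
proof (cases "null_seq X")
  case True
  assume "null_seq (X - Y)"
  with True have "null_seq Y" using null_seq_cong by blast
  with True show ?thesis by transfer simp
next
  case False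
  assume XY: "null_seq (X - Y)"
  with False have "\<not> null_seq Y" using null_seq_cong by blast
  with False XY show ?thesis by transfer (simp add: padic_null_inverse_diff[OF prime_card])
qed

lemma inverse_seq_mult: "\<not> null_seq X \<Longrightarrow> null_seq (inverse_seq X * X - 1)"
proof transfer
  fix X :: "nat \<Rightarrow> rat"
  let ?p = "CARD('a)"
  assume c: "padic_cauchy ?p X" and nz: "\<not> padic_null ?p X"
  obtain b k where bk: "b > 0" "\<And>n. n \<ge> k \<Longrightarrow> b < padic_abs ?p (X n)"
    using padic_cauchy_not_null[OF prime_card c nz] by blast
  have "eventually (\<lambda>n. padic_abs ?p (inverse (X n) * X n - 1) = 0) sequentially"
    using eventually_ge_at_top[of k]
  proof eventually_elim
    case (elim n)
    then have "X n \<noteq> 0" using bk(1) bk(2)[of n] by auto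
    then show ?case by simp
  qed
  then have "padic_null ?p (\<lambda>n. inverse (X n) * X n - 1)"
    unfolding padic_null_def by (rule tendsto_eventually)
  with nz show "padic_null ?p
      (\<lambda>n. (if padic_null ?p X then \<lambda>n. 0 else (\<lambda>n. inverse (X n))) n * X n - 1)"
    by simp
qed

lemma norm_seq_LIMSEQ:
  "(\<lambda>n. padic_abs CARD('p) (Rep_padic_seq X n)) \<longlonglongrightarrow> norm_seq (X::'p::prime_card padic_seq)"
  using padic_cauchy_abs_convergent[OF prime_card, of "Rep_padic_seq X"] Rep_padic_seq[of X]
  by (simp add: norm_seq.rep_eq convergent_LIMSEQ_iff)

lemma norm_seq_eq_0_iff: "norm_seq X = 0 \<longleftrightarrow> null_seq X"
  using norm_seq_LIMSEQ[of X] LIMSEQ_unique[OF norm_seq_LIMSEQ[of X], of 0]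
  by (auto simp: null_seq.rep_eq padic_null_def)

lemma norm_seq_minus: "norm_seq (- X) = norm_seq X"
  by transfer (simp add: padic_abs_minus prime_card)

lemma norm_seq_ultrametric: "norm_seq (X + Y) \<le> max (norm_seq X) (norm_seq Y)"
  by (rule LIMSEQ_le[OF norm_seq_LIMSEQ tendsto_max[OF norm_seq_LIMSEQ norm_seq_LIMSEQ]])
     (simp add: plus_padic_seq.rep_eq padic_abs_ultrametric prime_card)

lemma norm_seq_mult: "norm_seq (X * Y) = norm_seq X * norm_seq Y"
  by (rule LIMSEQ_unique[OF norm_seq_LIMSEQ])
     (simp add: times_padic_seq.rep_eq padic_abs_mult prime_card tendsto_mult norm_seq_LIMSEQ)

lemma norm_seq_nonneg: "0 \<le> norm_seq X"
  by (rule LIMSEQ_le_const[OF norm_seq_LIMSEQ]) auto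

lemma norm_seq_cong:
  assumes "null_seq (X - Y)"
  shows "norm_seq X = norm_seq Y"
proof -
  have "norm_seq (X - Y) = 0" "norm_seq (Y - X) = 0"
    using assms by (simp_all add: norm_seq_eq_0_iff null_seq_diff_commute)
  then show ?thesis
    using norm_seq_ultrametric[of "X - Y" Y] norm_seq_ultrametric[of "Y - X" X]
      norm_seq_nonneg[of X] norm_seq_nonneg[of Y] by simp
qed

definition padic_equiv :: "'p::prime_card padic_seq \<Rightarrow> 'p padic_seq \<Rightarrow> bool" where
  "padic_equiv X Y \<longleftrightarrow> null_seq (X - Y)"

quotient_type 'p padic = "'p::prime_card padic_seq" / padic_equiv
proof (rule equivpI)
  show "reflp (padic_equiv :: 'p padic_seq \<Rightarrow> _)"
    by (simp add: reflp_def padic_equiv_def)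
  show "symp (padic_equiv :: 'p padic_seq \<Rightarrow> _)"
    by (auto simp: symp_def padic_equiv_def intro: null_seq_diff_commute)
  show "transp (padic_equiv :: 'p padic_seq \<Rightarrow> _)"
  proof (rule transpI)
    fix X Y Z :: "'p padic_seq"
    assume "padic_equiv X Y" "padic_equiv Y Z"
    then show "padic_equiv X Z"
      using null_seq_add[of "X - Y" "Y - Z"] by (simp add: padic_equiv_def)
  qed
qed

instantiation padic :: (prime_card) field
begin

lift_definition zero_padic :: "'a padic" is 0 .

lift_definition one_padic :: "'a padic" is 1 .

lift_definition plus_padic :: "'a padic \<Rightarrow> 'a padic \<Rightarrow> 'a padic" is "(+)"
  unfolding padic_equiv_def add_diff_add by (rule null_seq_add)

lift_definition uminus_padic :: "'a padic \<Rightarrow> 'a padic" is uminus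
  unfolding padic_equiv_def minus_diff_minus by (rule null_seq_minus)

lift_definition minus_padic :: "'a padic \<Rightarrow> 'a padic \<Rightarrow> 'a padic" is "(-)"
proof -
  fix X X' Y Y' :: "'a padic_seq"
  assume "padic_equiv X X'" "padic_equiv Y Y'"
  then show "padic_equiv (X - Y) (X' - Y')"
    using null_seq_add[of "X - X'" "- (Y - Y')"] null_seq_minus[of "Y - Y'"]
    by (simp add: padic_equiv_def algebra_simps)
qed

lift_definition times_padic :: "'a padic \<Rightarrow> 'a padic \<Rightarrow> 'a padic" is "(*)"
proof -
  fix X X' Y Y' :: "'a padic_seq"
  assume "padic_equiv X X'" "padic_equiv Y Y'"
  then show "padic_equiv (X * Y) (X' * Y')"
    using null_seq_add[of "X * (Y - Y')" "Y' * (X - X')"]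
      null_seq_mult[of "Y - Y'" X] null_seq_mult[of "X - X'" Y']
    by (simp add: padic_equiv_def algebra_simps)
qed

lift_definition inverse_padic :: "'a padic \<Rightarrow> 'a padic" is inverse_seq
  unfolding padic_equiv_def by (rule inverse_seq_cong)

definition divide_padic :: "'a padic \<Rightarrow> 'a padic \<Rightarrow> 'a padic" where
  "divide_padic x y = x * inverse y"

instance
proof
  fix a b c :: "'a padic"
  show "a + b + c = a + (b + c)"
    by transfer (simp add: padic_equiv_def algebra_simps)
  show "a + b = b + a"
    by transfer (simp add: padic_equiv_def algebra_simps)
  show "0 + a = a"
    by transfer (simp add: padic_equiv_def)
  show "- a + a = 0"
    by transfer (simp add: padic_equiv_def)
  show "a - b = a + - b"
    by transfer (simp add: padic_equiv_def)
  show "a * b * c = a * (b * c)"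
    by transfer (simp add: padic_equiv_def algebra_simps)
  show "a * b = b * a"
    by transfer (simp add: padic_equiv_def algebra_simps)
  show "1 * a = a"
    by transfer (simp add: padic_equiv_def)
  show "(a + b) * c = a * c + b * c"
    by transfer (simp add: padic_equiv_def algebra_simps)
  show "(0::'a padic) \<noteq> 1"
    by transfer (use null_seq_minus[of "- 1"] in \<open>auto simp: padic_equiv_def not_null_seq_1\<close>)
  show "inverse a * a = 1" if "a \<noteq> 0"
    using that by transfer (simp add: padic_equiv_def inverse_seq_mult)
  show "a div b = a * inverse b"
    by (rule divide_padic_def)
  have "inverse_seq (0 :: 'a padic_seq) = 0"
    by transfer simp
  then show "inverse (0::'a padic) = 0"
    by transfer (simp add: padic_equiv_def)
qed

end

lift_definition padic_norm :: "'p::prime_card padic \<Rightarrow> real" is norm_seq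
  unfolding padic_equiv_def by (rule norm_seq_cong)

lemma padic_norm_eq_0_iff: "padic_norm (x::'a::prime_card padic) = 0 \<longleftrightarrow> x = 0"
  by transfer (simp add: norm_seq_eq_0_iff padic_equiv_def)

lemma padic_norm_minus: "padic_norm (- x::'a::prime_card padic) = padic_norm x"
  by transfer (rule norm_seq_minus)

lemma padic_norm_ultrametric: "padic_norm (x + y::'a::prime_card padic) \<le> max (padic_norm x) (padic_norm y)"
  by transfer (rule norm_seq_ultrametric)

lemma padic_norm_nonneg: "0 \<le> padic_norm (x::'a::prime_card padic)"
  by transfer (rule norm_seq_nonneg)

lemma padic_norm_mult: "padic_norm (x * y::'a::prime_card padic) = padic_norm x * padic_norm y"
  by transfer (rule norm_seq_mult)

lemma padic_norm_of_nat: "padic_norm (of_nat n :: 'a::prime_card padic) = padic_abs CARD('a) (of_nat n)"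
proof -
  have 1: "of_nat n = abs_padic (of_nat n :: 'a padic_seq)"
    by (induction n) (simp_all add: zero_padic.abs_eq one_padic.abs_eq plus_padic.abs_eq)
  have 2: "Rep_padic_seq (of_nat n :: 'a padic_seq) = (\<lambda>_. of_nat n)"
    by (induction n) (simp_all add: zero_padic_seq.rep_eq one_padic_seq.rep_eq plus_padic_seq.rep_eq)
  show ?thesis
    unfolding 1 by (simp add: padic_norm.abs_eq norm_seq.rep_eq 2)
qed

instantiation padic :: (prime_card) metric_space
begin

definition dist_padic :: "'a padic \<Rightarrow> 'a padic \<Rightarrow> real" where
  "dist_padic x y = padic_norm (x - y)"

definition uniformity_padic :: "('a padic \<times> 'a padic) filter" where
  "uniformity_padic = (INF e\<in>{0 <..}. principal {(x, y). dist x y < e})"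

definition open_padic :: "'a padic set \<Rightarrow> bool" where
  "open_padic U \<longleftrightarrow> (\<forall>x\<in>U. eventually (\<lambda>(x', y). x' = x \<longrightarrow> y \<in> U) uniformity)"

instance
proof
  show "uniformity = (INF e\<in>{0 <..}. principal {(x, y :: 'a padic). dist x y < e})"
    by (rule uniformity_padic_def)
  show "open U \<longleftrightarrow> (\<forall>x\<in>U. eventually (\<lambda>(x', y). x' = x \<longrightarrow> y \<in> U) uniformity)"
    for U :: "'a padic set"
    by (rule open_padic_def)
  show "dist x y = 0 \<longleftrightarrow> x = y" for x y :: "'a padic"
    by (simp add: dist_padic_def padic_norm_eq_0_iff)
  show "dist x y \<le> dist x z + dist y z" for x y z :: "'a padic"
    using padic_norm_ultrametric[of "x - z" "z - y"] padic_norm_minus[of "y - z"]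
      padic_norm_nonneg[of "x - z"] padic_norm_nonneg[of "y - z"]
    by (simp add: dist_padic_def)
qed

end


section \<open>Fractional part and additive character\<close>

text \<open>
  \<open>d j\<close> is the digit \<open>x\<^sub>j\<close> in \<open>x = p\<^sup>\<gamma>(x\<^sub>0 + x\<^sub>1 p + x\<^sub>2 p\<^sup>2 + \<dots>)\<close>, a series converging in the
  \<open>p\<close>-adic topology.
\<close>

definition padic_expansion :: "'p::prime_card padic \<Rightarrow> int \<Rightarrow> (nat \<Rightarrow> nat) \<Rightarrow> bool" where
  "padic_expansion x \<gamma> d \<longleftrightarrow> (\<forall>j. d j < CARD('p)) \<and> d 0 \<noteq> 0 \<and>
     (\<lambda>j. of_nat CARD('p) powi \<gamma> * (of_nat (d j) * of_nat CARD('p) ^ j)) sums x"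

definition padic_int :: "'p::prime_card padic set" where
  "padic_int = {x. padic_norm x \<le> 1}"

definition padic_frac :: "'p::prime_card padic \<Rightarrow> real" where
  "padic_frac x = (if x \<in> padic_int then 0
     else (THE r. \<exists>\<gamma><0. \<exists>d. padic_expansion x \<gamma> d \<and>
       r = real CARD('p) powi \<gamma> * (\<Sum>j<nat \<bar>\<gamma>\<bar>. real (d j) * real CARD('p) ^ j)))"

definition padic_char :: "'p::prime_card padic \<Rightarrow> complex" where
  "padic_char x = exp (2 * of_real pi * \<i> * of_real (padic_frac x))"


section \<open>Normalized Haar measure and square-integrable functions\<close>

text \<open>
  A translation-invariant Borel measure giving the compact open unit ball measure \<open>1\<close> is finite on
  compact sets, so it is the normalized Haar measure; regularity is automatic because the space is
  locally compact and second countable.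
\<close>

definition padic_haar :: "'p::prime_card padic measure \<Rightarrow> bool" where
  "padic_haar \<mu> \<longleftrightarrow> sets \<mu> = sets borel \<and>
     (\<forall>a. \<forall>A\<in>sets borel. emeasure \<mu> ((\<lambda>x. a + x) ` A) = emeasure \<mu> A) \<and>
     emeasure \<mu> padic_int = 1"

text \<open>Elements of \<open>L\<^sup>2(\<mu>)\<close> are represented by functions, equality being almost everywhere.\<close>

definition L2 :: "'a measure \<Rightarrow> ('a \<Rightarrow> complex) set" where
  "L2 \<mu> = {f \<in> borel_measurable \<mu>. integrable \<mu> (\<lambda>x. (cmod (f x))\<^sup>2)}"

definition L2_inner :: "'a measure \<Rightarrow> ('a \<Rightarrow> complex) \<Rightarrow> ('a \<Rightarrow> complex) \<Rightarrow> complex" where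
  "L2_inner \<mu> f g = (LINT x|\<mu>. f x * cnj (g x))"

definition L2_norm :: "'a measure \<Rightarrow> ('a \<Rightarrow> complex) \<Rightarrow> real" where
  "L2_norm \<mu> f = sqrt (LINT x|\<mu>. (cmod (f x))\<^sup>2)"

text \<open>Completeness: the finite linear combinations of the family are dense in \<open>L\<^sup>2(\<mu>)\<close>.\<close>

definition orthonormal_basis_L2 ::
    "'a measure \<Rightarrow> 'i set \<Rightarrow> ('i \<Rightarrow> 'a \<Rightarrow> complex) \<Rightarrow> bool" where
  "orthonormal_basis_L2 \<mu> I \<theta> \<longleftrightarrow>
     (\<forall>i\<in>I. \<theta> i \<in> L2 \<mu>) \<and>
     (\<forall>i\<in>I. \<forall>j\<in>I. L2_inner \<mu> (\<theta> i) (\<theta> j) = (if i = j then 1 else 0)) \<and>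
     (\<forall>f\<in>L2 \<mu>. \<forall>\<epsilon>>0. \<exists>F c. finite F \<and> F \<subseteq> I \<and>
        L2_norm \<mu> (\<lambda>x. f x - (\<Sum>i\<in>F. c i * \<theta> i x)) < \<epsilon>)"


section \<open>The wavelet functions\<close>

text \<open>Only its values on \<open>t \<ge> 0\<close> matter.\<close>

definition Omega :: "real \<Rightarrow> real" where
  "Omega t = (if t \<le> 1 then 1 else 0)"

definition I_set :: "'p::prime_card padic set" where
  "I_set = {of_nat CARD('p) powi (- int k) * (\<Sum>j<k. of_nat (a j) * of_nat CARD('p) ^ j) | k a.
     k \<ge> 1 \<and> (\<forall>j<k. a j < CARD('p))}"

definition J_set :: "nat \<Rightarrow> 'p::prime_card padic set" where
  "J_set m = {of_nat CARD('p) powi (- int m) * (\<Sum>j<m. of_nat (s j) * of_nat CARD('p) ^ j) | s.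
     (\<forall>j<m. s j < CARD('p)) \<and> s 0 \<noteq> 0}"

definition theta ::
    "int \<times> 'p::prime_card padic \<times> 'p padic \<Rightarrow> 'p padic \<Rightarrow> complex" where
  "theta = (\<lambda>(\<gamma>, s, a) x.
     of_real (real CARD('p) powr (- real_of_int \<gamma> / 2)) *
     padic_char (s * (of_nat CARD('p) powi \<gamma> * x - a)) *
     of_real (Omega (padic_norm (of_nat CARD('p) powi \<gamma> * x - a))))"

end

theory Submission
  imports Defs
begin

text \<open>
  A ball of radius \<open>p\<^sup>\<gamma>\<close> is a translated and scaled copy of \<open>\<int>\<^sub>p\<close>, and \<open>s \<in> J_set m\<close> runs through the
  characters of \<open>\<int>\<^sub>p\<close> of exact conductor \<open>p\<^sup>m\<close>.  For two different wavelets with intersecting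
  supports, the product of one with the conjugate of the other is, on the smaller ball, a constant
  times a character that is nontrivial there, so its integral vanishes by translation invariance.
  For completeness, Fourier inversion on \<open>\<int>\<^sub>p / p\<^sup>m\<int>\<^sub>p\<close> shows that the indicator of a ball equals
  \<open>1/p\<close> times the indicator of the next larger ball modulo finite combinations of wavelets.  After
  \<open>k\<close> steps the remainder has squared norm of order \<open>p\<^sup>-\<^sup>k\<close>, so indicators of balls lie in the closed span;
  since balls form a countable \<open>\<inter>\<close>-stable generator of the Borel sets, a Dynkin argument and
  an approximation by simple functions give all of \<open>L\<^sup>2\<close>.
\<close>

section \<open>Arithmetic of the \<open>p\<close>-adic norm\<close>

text \<open>The substitute is approximation by naturals: an x of norm at most p^k is within distance
  1 of some N/p^k with N < p^k, and the fraction N/p^k is unique. Fractional part, character and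
  both index sets are read off from such N.

  The factor 1/p in the completeness argument comes from the restriction to primitive s. All
  characters of Z_p/p^m Z_p add up to p^m times the indicator of p^m Z_p; those with numerator
  divisible by p are the characters of Z_p/p^(m-1) Z_p and add up to p^(m-1) times the indicator of
  p^(m-1) Z_p.

  Each wavelet has integral 0 and the indicator of a ball does not, yet the wavelets alone suffice:
  passing to larger balls keeps the integral of the remainder fixed but spreads it out, so the
  remainder tends to 0 in L^2, though not in L^1.\<close>

abbreviation padic_p :: "'p::prime_card padic" where
  "padic_p \<equiv> of_nat CARD('p)"

lemma CARD_gt_1: "1 < CARD('p::prime_card)"
  using prime_card[where 'a = 'p] prime_gt_1_nat by blast

lemma CARD_powi_pos [simp]: "0 < real CARD('p::prime_card) powi n"
  using CARD_gt_1[where 'p = 'p] by (simp add: zero_less_power_int)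

lemma CARD_powi_less_iff [simp]:
  "real CARD('p::prime_card) powi i < real CARD('p) powi j \<longleftrightarrow> i < j"
proof (cases i j rule: linorder_cases)
  case greater
  then show ?thesis
    using power_int_strict_increasing[of j i "real CARD('p)"] CARD_gt_1[where 'p = 'p] by simp
qed (use power_int_strict_increasing[of i j "real CARD('p)"] CARD_gt_1[where 'p = 'p] in simp_all)

lemma CARD_powi_le_iff [simp]:
  "real CARD('p::prime_card) powi i \<le> real CARD('p) powi j \<longleftrightarrow> i \<le> j"
  unfolding not_less[symmetric] by simp

lemma CARD_powi_le_1_iff [simp]: "real CARD('p::prime_card) powi i \<le> 1 \<longleftrightarrow> i \<le> 0"
  using CARD_powi_le_iff[where 'p = 'p, of i 0] by (simp del: CARD_powi_le_iff)

lemma CARD_powi_add: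
  "real CARD('p::prime_card) powi (i + j) = real CARD('p) powi i * real CARD('p) powi j"
  using CARD_gt_1[where 'p = 'p] by (intro power_int_add) simp

lemma LIMSEQ_CARD_powi:
  "(\<lambda>n. real CARD('p::prime_card) powi (i - int n)) \<longlonglongrightarrow> 0"
proof -
  have "(\<lambda>n. (1 / real CARD('p)) ^ n) \<longlonglongrightarrow> 0"
    using CARD_gt_1[where 'p = 'p] by (intro LIMSEQ_power_zero) simp
  then have "(\<lambda>n. real CARD('p) powi i * (1 / real CARD('p)) ^ n) \<longlonglongrightarrow> 0"
    by (rule tendsto_mult_right_zero)
  moreover have "real CARD('p) powi i * (1 / real CARD('p)) ^ n = real CARD('p) powi (i - int n)" for n
    using CARD_gt_1[where 'p = 'p] by (simp add: power_int_diff power_divide)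
  ultimately show ?thesis by simp
qed

lemma ex_CARD_powi_less:
  assumes "0 < e"
  obtains n :: nat where "real CARD('p::prime_card) powi (i - int n) < e"
  using order_tendstoD(2)[OF LIMSEQ_CARD_powi[where 'p = 'p, of i] assms]
  by (auto simp: eventually_sequentially)

lemma padic_norm_0 [simp]: "padic_norm 0 = 0"
  by (simp add: padic_norm_eq_0_iff)

lemma padic_norm_1 [simp]: "padic_norm (1 :: 'p::prime_card padic) = 1"
  using padic_norm_of_nat[where 'a = 'p, of 1] by (simp add: prime_card)

lemma padic_norm_minus_commute: "padic_norm (x - y) = padic_norm (y - x)"
  using padic_norm_minus[of "x - y"] by simp

lemma padic_norm_add_le: "padic_norm x \<le> r \<Longrightarrow> padic_norm y \<le> r \<Longrightarrow> padic_norm (x + y) \<le> r"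
  using padic_norm_ultrametric[of x y] by simp

lemma padic_norm_diff_le: "padic_norm x \<le> r \<Longrightarrow> padic_norm y \<le> r \<Longrightarrow> padic_norm (x - y) \<le> r"
  using padic_norm_add_le[of x r "- y"] by (simp add: padic_norm_minus)

lemma padic_norm_diff_le_trans:
  "padic_norm (x - y) \<le> r \<Longrightarrow> padic_norm (y - z) \<le> r \<Longrightarrow> padic_norm (x - z) \<le> r"
  using padic_norm_add_le[of "x - y" r "y - z"] by simp

text \<open>Isosceles triangle principle: the ultrametric inequality, applied in both directions,
  leaves no room for a change of norm. It transfers norms from naturals to nearby points and later
  finds the norm of a difference with one dominant term.\<close>

lemma padic_norm_eqI:
  assumes "padic_norm (x - y) < padic_norm x"
  shows "padic_norm y = padic_norm x"
  using padic_norm_ultrametric[of "x - y" y] padic_norm_ultrametric[of "y - x" x] assms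
  by (simp add: padic_norm_minus_commute[of y x])

lemma padic_norm_inverse: "padic_norm (inverse x) = inverse (padic_norm x)"
proof (cases "x = 0")
  case False
  then have "padic_norm x * padic_norm (inverse x) = 1"
    by (simp flip: padic_norm_mult)
  then show ?thesis using False by (simp add: inverse_unique)
qed simp

lemma padic_norm_power: "padic_norm (x ^ n) = padic_norm x ^ n"
  by (induction n) (simp_all add: padic_norm_mult)

lemma padic_norm_power_int: "padic_norm (x powi n) = padic_norm x powi n"
  by (simp add: power_int_def padic_norm_power padic_norm_inverse)

lemma padic_norm_of_int: "padic_norm (of_int a :: 'p::prime_card padic) = padic_abs CARD('p) (of_int a)"
  by (cases a rule: int_cases2) (simp_all add: padic_norm_of_nat padic_norm_minus padic_abs_minus prime_card)

lemma padic_norm_of_int_eq: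
  assumes "a \<noteq> 0"
  shows "padic_norm (of_int a :: 'p::prime_card padic)
    = real CARD('p) powi (- int (multiplicity (int CARD('p)) a))"
  using padic_val_Fract[of "CARD('p)" a 1] assms
  by (simp add: padic_norm_of_int padic_abs_def prime_card Fract_of_int_eq)

text \<open>The bridge between norm bounds and congruences modulo powers of p; every later passage
  between the two goes through it.\<close>

lemma padic_norm_of_int_le_iff:
  "padic_norm (of_int a :: 'p::prime_card padic) \<le> real CARD('p) powi (- int n)
    \<longleftrightarrow> int CARD('p) ^ n dvd a"
proof (cases "a = 0")
  case False
  have "\<not> is_unit (int CARD('p))"
    using prime_card_int[where 'a = 'p] not_prime_unit by blast
  then show ?thesis
    using False by (simp add: padic_norm_of_int_eq power_dvd_iff_le_multiplicity)
qed simp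

lemma padic_norm_of_int_le_1 [simp]: "padic_norm (of_int a :: 'p::prime_card padic) \<le> 1"
  using padic_norm_of_int_le_iff[where 'p = 'p, of a 0] by simp

lemma padic_norm_of_nat_le_1 [simp]: "padic_norm (of_nat a :: 'p::prime_card padic) \<le> 1"
  using padic_norm_of_int_le_1[where 'p = 'p, of "int a"] by simp

lemma padic_norm_p: "padic_norm (padic_p :: 'p::prime_card padic) = inverse (real CARD('p))"
  using padic_norm_of_int_eq[where 'p = 'p, of "int CARD('p)"] CARD_gt_1[where 'p = 'p]
    prime_card_int[where 'a = 'p] by (simp add: power_int_minus)

lemma padic_p_nonzero [simp]: "(padic_p :: 'p::prime_card padic) \<noteq> 0"
  using padic_norm_p[where 'p = 'p] CARD_gt_1[where 'p = 'p]
  by (auto simp flip: padic_norm_eq_0_iff)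

lemma padic_norm_p_powi: "padic_norm (padic_p powi n :: 'p::prime_card padic) = real CARD('p) powi (- n)"
  by (simp add: padic_norm_power_int padic_norm_p power_int_minus power_int_inverse)

lemma padic_norm_p_powi_mult_le_iff:
  "padic_norm (padic_p powi i * x :: 'p::prime_card padic) \<le> real CARD('p) powi j
    \<longleftrightarrow> padic_norm x \<le> real CARD('p) powi (i + j)"
  using CARD_gt_1[where 'p = 'p]
  by (simp add: padic_norm_mult padic_norm_p_powi power_int_minus CARD_powi_add field_simps)

lemma padic_norm_p_powi_mult_le_1_iff:
  "padic_norm (padic_p powi i * x :: 'p::prime_card padic) \<le> 1 \<longleftrightarrow> padic_norm x \<le> real CARD('p) powi i"
  using padic_norm_p_powi_mult_le_iff[where j = 0] by simp

text \<open>A late term a/b of a representing Cauchy sequence is already close to the limit. The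
  denominator is cleared so that only images of integers occur and no embedding of the rationals has
  to be set up.\<close>

lemma padic_approx_rat:
  fixes x :: "'p::prime_card padic"
  assumes "0 < e"
  obtains a b where "coprime a b" "b \<noteq> 0"
    "padic_norm (of_int b * x - of_int a) \<le> padic_norm (of_int b :: 'p padic) * e"
proof -
  obtain X :: "'p padic_seq" where x: "x = abs_padic X"
    by (metis Quotient_abs_rep[OF Quotient_padic])
  obtain k where k: "\<And>m n. m \<ge> k \<Longrightarrow> n \<ge> k \<Longrightarrow>
      padic_abs CARD('p) (Rep_padic_seq X m - Rep_padic_seq X n) < e"
    using padic_cauchyD[of "CARD('p)" "Rep_padic_seq X" e] Rep_padic_seq[of X] assms by auto
  obtain a b where ab: "Rep_padic_seq X k = Rat.Fract a b" "b > 0" "coprime a b"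
    by (cases "Rep_padic_seq X k")
  have q: "Rep_padic_seq X k = of_int a / of_int b"
    using ab by (simp add: Fract_of_int_quotient)
  \<comment> \<open>Integers are the classes of constant sequences, so the norm of b x - a can be
    evaluated on representatives.\<close>
  have of_nat: "of_nat c = abs_padic (of_nat c :: 'p padic_seq)" for c
    by (induction c) (simp_all add: zero_padic.abs_eq one_padic.abs_eq plus_padic.abs_eq)
  have of_int: "of_int c = abs_padic (of_int c :: 'p padic_seq)" for c
    by (cases c rule: int_cases2) (simp_all add: of_nat uminus_padic.abs_eq)
  have Rep_of_nat: "Rep_padic_seq (of_nat c :: 'p padic_seq) = (\<lambda>_. of_nat c)" for c
    by (induction c) (simp_all add: zero_padic_seq.rep_eq one_padic_seq.rep_eq plus_padic_seq.rep_eq)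
  have Rep_of_int: "Rep_padic_seq (of_int c :: 'p padic_seq) = (\<lambda>_. of_int c)" for c
    by (cases c rule: int_cases2) (simp_all add: Rep_of_nat uminus_padic_seq.rep_eq)
  have norm: "padic_norm (of_int b * x - of_int a) = norm_seq (of_int b * X - of_int a)"
    by (simp add: x of_int times_padic.abs_eq minus_padic.abs_eq padic_norm.abs_eq)
  have "padic_abs CARD('p) (Rep_padic_seq (of_int b * X - of_int a) n)
      \<le> padic_norm (of_int b :: 'p padic) * e" if "n \<ge> k" for n
  proof -
    have "Rep_padic_seq (of_int b * X - of_int a) n
        = of_int b * (Rep_padic_seq X n - Rep_padic_seq X k)"
      using ab(2) by (simp add: minus_padic_seq.rep_eq times_padic_seq.rep_eq Rep_of_int q algebra_simps)
    then show ?thesis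
      using k[OF that, of k] by (simp add: padic_abs_mult prime_card padic_norm_of_int mult_left_mono)
  qed
  then have "norm_seq (of_int b * X - of_int a) \<le> padic_norm (of_int b :: 'p padic) * e"
    by (intro LIMSEQ_le_const2[OF norm_seq_LIMSEQ]) auto
  then show thesis using that[of a b] ab norm by simp
qed

text \<open>Take a rational approximation a/b in lowest terms. If p divided b, the bound on y would
  give a norm at most that of b, hence p would divide a as well. So b is a unit modulo p^n, and N is
  a times its inverse, reduced modulo p^n.\<close>

lemma padic_int_approx:
  fixes y :: "'p::prime_card padic"
  assumes y: "padic_norm y \<le> 1"
  obtains N where "N < CARD('p) ^ n" "padic_norm (y - of_nat N) \<le> real CARD('p) powi (- int n)"
proof -
  define e where "e = real CARD('p) powi (- int n)"
  have e: "0 < e" "e \<le> 1" by (simp_all add: e_def)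
  obtain a b where ab: "coprime a b" "b \<noteq> 0"
    "padic_norm (of_int b * y - of_int a) \<le> padic_norm (of_int b :: 'p padic) * e"
    using padic_approx_rat[OF e(1)] by blast
  let ?p = "int CARD('p)"
  have p: "prime ?p" by (rule prime_card_int)
  have "\<not> ?p dvd b"
  proof
    assume b: "?p dvd b"
    have "padic_norm (of_int a :: 'p padic) \<le> padic_norm (of_int b :: 'p padic)"
    proof -
      have "padic_norm (of_int b * y) \<le> padic_norm (of_int b :: 'p padic)"
        using y padic_norm_nonneg by (auto simp: padic_norm_mult intro: mult_left_le)
      moreover have "padic_norm (of_int b :: 'p padic) * e \<le> padic_norm (of_int b :: 'p padic)"
        using e padic_norm_nonneg by (auto intro: mult_left_le)
      ultimately show ?thesis
        using padic_norm_diff_le[of "of_int b * y" _ "of_int b * y - of_int a"] ab(3) by simp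
    qed
    also have "\<dots> \<le> real CARD('p) powi (- int 1)"
      unfolding padic_norm_of_int_le_iff using b by simp
    finally have "?p dvd a" unfolding padic_norm_of_int_le_iff by simp
    with b ab(1) p show False by (meson coprime_common_divisor not_prime_unit)
  qed
  then have cop: "coprime b ?p"
    using p prime_imp_coprime coprime_commute by blast
  then obtain c where c: "[b * c = 1] (mod ?p ^ n)"
    by (meson cong_solve_coprime_int coprime_power_right_iff)
  define N where "N = nat ((a * c) mod ?p ^ n)"
  have N: "int N = (a * c) mod ?p ^ n"
    using CARD_gt_1[where 'p = 'p] by (simp add: N_def)
  have "int N < ?p ^ n"
    using CARD_gt_1[where 'p = 'p] by (simp add: N)
  then have "int N < int (CARD('p) ^ n)" by simp
  then have N_less: "N < CARD('p) ^ n" by (simp only: of_nat_less_iff)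
  have "[b * int N = b * (a * c)] (mod ?p ^ n)"
    unfolding N by (intro cong_mult) (simp_all add: cong_def)
  also have "[b * (a * c) = a] (mod ?p ^ n)"
    using cong_mult[OF cong_refl[of a] c] by (simp add: ac_simps)
  finally have "?p ^ n dvd a - b * int N"
    by (simp add: cong_iff_dvd_diff dvd_diff_commute)
  then have 1: "padic_norm (of_int (a - b * int N) :: 'p padic) \<le> e"
    unfolding e_def padic_norm_of_int_le_iff .
  have "multiplicity ?p b = 0" using \<open>\<not> ?p dvd b\<close> by (rule not_dvd_imp_multiplicity_0)
  then have b1: "padic_norm (of_int b :: 'p padic) = 1"
    using ab(2) by (simp add: padic_norm_of_int_eq)
  have "padic_norm (of_int b * (y - of_nat N)) \<le> e"
    using padic_norm_add_le[OF _ 1, of "of_int b * y - of_int a"] ab(3) b1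
    by (simp add: algebra_simps)
  then show thesis
    using that[OF N_less] b1 by (simp add: padic_norm_mult e_def)
qed

text \<open>Discreteness of the value group. Scaled into the unit ball, x can be approximated by a
  natural number more closely than its own norm; the two norms then agree, and the norm of a natural
  is determined by its multiplicity at p.\<close>

lemma padic_norm_eq_powi:
  fixes x :: "'p::prime_card padic"
  assumes "x \<noteq> 0"
  obtains n where "padic_norm x = real CARD('p) powi n"
proof -
  obtain k where k: "real CARD('p) powi (0 - int k) < 1 / padic_norm x"
    using ex_CARD_powi_less[where 'p = 'p, of "1 / padic_norm x"] assms padic_norm_eq_0_iff[of x] padic_norm_nonneg[of x]
    by (metis less_eq_real_def zero_less_divide_1_iff)
  define y where "y = padic_p powi int k * x"
  have pos: "padic_norm x > 0"
    using assms padic_norm_eq_0_iff[of x] padic_norm_nonneg[of x] by linarith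
  have ny: "padic_norm y = real CARD('p) powi (- int k) * padic_norm x"
    unfolding y_def padic_norm_mult padic_norm_p_powi ..
  have y: "padic_norm y \<le> 1" "padic_norm y > 0"
    using k pos by (simp_all add: ny field_simps)
  obtain n where n: "real CARD('p) powi (0 - int n) < padic_norm y"
    using ex_CARD_powi_less[where 'p = 'p, of "padic_norm y"] y by blast
  obtain N where "padic_norm (y - of_nat N) \<le> real CARD('p) powi (- int n)"
    using padic_int_approx[OF y(1)] by blast
  then have N: "padic_norm (of_nat N :: 'p padic) = padic_norm y"
    using n by (intro padic_norm_eqI) simp
  then have "N \<noteq> 0" using y by (intro notI) simp
  then have "padic_norm y = real CARD('p) powi (- int (multiplicity (int CARD('p)) (int N)))"
    using padic_norm_of_int_eq[where 'p = 'p, of "int N"] N by simp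
  then have "padic_norm x = real CARD('p) powi (int k - int (multiplicity (int CARD('p)) (int N)))"
    using ny CARD_gt_1[where 'p = 'p]
    by (simp add: power_int_diff power_int_minus field_simps)
  then show thesis by (rule that)
qed

lemma padic_norm_gt_powi:
  fixes x :: "'p::prime_card padic"
  assumes "real CARD('p) powi n < padic_norm x"
  shows "real CARD('p) powi (n + 1) \<le> padic_norm x"
proof -
  have "0 < padic_norm x"
    using CARD_powi_pos[where 'p = 'p, of n] assms by linarith
  then have "x \<noteq> 0" by auto
  then obtain k where "padic_norm x = real CARD('p) powi k" by (rule padic_norm_eq_powi)
  with assms show ?thesis by simp
qed

text \<open>Uniqueness counterpart of \<open>padic_int_approx\<close>: naturals below p^k lie in
  distinct residue classes.\<close>

lemma padic_norm_of_nat_diff_eq: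
  assumes "M < CARD('p) ^ k" "N < CARD('p) ^ k"
    "padic_norm (of_nat M - of_nat N :: 'p::prime_card padic) \<le> real CARD('p) powi (- int k)"
  shows "M = N"
proof -
  have "padic_norm (of_int (int M - int N) :: 'p padic) \<le> real CARD('p) powi (- int k)"
    using assms(3) by simp
  then have "int CARD('p) ^ k dvd int M - int N"
    unfolding padic_norm_of_int_le_iff .
  then have "int (CARD('p) ^ k) dvd int M - int N" by simp
  then show ?thesis
    using assms(1,2) by (metis cong_iff_dvd_diff cong_int_iff cong_less_modulus_unique_nat)
qed

section \<open>Fractional parts and the additive character\<close>

lemma sum_digits_less:
  fixes b :: nat
  assumes "\<And>j. j < n \<Longrightarrow> a j < b"
  shows "(\<Sum>j<n. a j * b ^ j) < b ^ n"
  using assms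
proof (induction n)
  case (Suc n)
  have "a n * b ^ n + b ^ n \<le> b * b ^ n"
    using Suc.prems[of n] mult_le_mono1[of "Suc (a n)" b "b ^ n"] by simp
  then show ?case using Suc.IH Suc.prems by (simp add: less_Suc_eq)
qed simp

lemma sum_digits_eq:
  fixes b :: nat
  shows "(\<Sum>j<n. (N div b ^ j mod b) * b ^ j) = N mod b ^ n"
proof (induction n)
  case (Suc n)
  then show ?case
    using mod_mult2_eq[of N "b ^ n" b] by (simp add: mult.commute)
qed simp

lemma sum_digits_diff_dvd:
  fixes b :: nat
  assumes "n \<le> l"
  shows "int b ^ n dvd int (\<Sum>j<l. a j * b ^ j) - int (\<Sum>j<n. a j * b ^ j)"
proof -
  have "(\<Sum>j<l. a j * b ^ j) = (\<Sum>j<n. a j * b ^ j) + (\<Sum>j=n..<l. a j * b ^ j)"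
    using assms by (simp add: sum.atLeastLessThan_concat lessThan_atLeast0)
  moreover have "int b ^ n dvd int (\<Sum>j=n..<l. a j * b ^ j)"
    by (auto intro!: dvd_sum dvd_mult le_imp_power_dvd)
  ultimately show ?thesis by simp
qed

text \<open>Multiplying by p^(k+l) turns both approximations into naturals below p^(k+l) that are
  congruent modulo p^(k+l). The conclusion is N/p^k = M/p^l with denominators cleared. It makes the
  fractional part well defined and separates the points of \<open>I_set\<close>.\<close>

lemma padic_approx_unique:
  fixes x :: "'p::prime_card padic"
  assumes N: "N < CARD('p) ^ k" "padic_norm (x - padic_p powi (- int k) * of_nat N) \<le> 1"
    and M: "M < CARD('p) ^ l" "padic_norm (x - padic_p powi (- int l) * of_nat M) \<le> 1"
  shows "N * CARD('p) ^ l = M * CARD('p) ^ k"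
proof (rule padic_norm_of_nat_diff_eq)
  show "N * CARD('p) ^ l < CARD('p) ^ (k + l)"
    using N(1) by (simp add: power_add)
  show "M * CARD('p) ^ k < CARD('p) ^ (k + l)"
    using M(1) by (simp add: power_add)
  let ?a = "padic_p powi (- int k) * of_nat N :: 'p padic"
  let ?b = "padic_p powi (- int l) * of_nat M :: 'p padic"
  have "padic_norm (?a - ?b) \<le> 1"
    using padic_norm_diff_le[OF M(2) N(2)] by simp
  then have "padic_norm (padic_p powi int (k + l) * (?a - ?b)) \<le> real CARD('p) powi (- int (k + l))"
    unfolding padic_norm_p_powi_mult_le_iff by simp
  moreover have "padic_p powi int (k + l) * (?a - ?b)
      = of_nat (N * CARD('p) ^ l) - of_nat (M * CARD('p) ^ k)"
    unfolding power_int_of_nat power_add by (simp add: power_int_minus field_simps)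
  ultimately show "padic_norm (of_nat (N * CARD('p) ^ l) - of_nat (M * CARD('p) ^ k) :: 'p padic)
      \<le> real CARD('p) powi (- int (k + l))"
    by simp
qed

text \<open>By convergence some later partial sum is as close to x as required, and it differs from
  the n-th one by a multiple of p^(\<gamma>+n).\<close>

lemma padic_expansion_approx:
  fixes x :: "'p::prime_card padic"
  assumes "padic_expansion x \<gamma> d"
  shows "padic_norm (x - padic_p powi \<gamma> * of_nat (\<Sum>j<n. d j * CARD('p) ^ j))
    \<le> real CARD('p) powi (- \<gamma> - int n)"
proof -
  define S :: "nat \<Rightarrow> 'p padic" where
    "S = (\<lambda>n. padic_p powi \<gamma> * of_nat (\<Sum>j<n. d j * CARD('p) ^ j))"
  have "S \<longlonglongrightarrow> x"
    using assms by (simp add: padic_expansion_def sums_def S_def sum_distrib_left)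
  then have "eventually (\<lambda>l. dist (S l) x < real CARD('p) powi (- \<gamma> - int n)) sequentially"
    by (rule tendstoD) simp
  then obtain l where l: "l \<ge> n" "padic_norm (S l - x) < real CARD('p) powi (- \<gamma> - int n)"
    unfolding eventually_sequentially dist_padic_def by (meson nle_le order_refl)
  have "S l - S n = padic_p powi \<gamma> *
      of_int (int (\<Sum>j<l. d j * CARD('p) ^ j) - int (\<Sum>j<n. d j * CARD('p) ^ j))"
    unfolding S_def by (simp only: right_diff_distrib of_int_diff of_int_of_nat_eq)
  also have "padic_norm \<dots> \<le> real CARD('p) powi (- \<gamma> - int n)"
  proof -
    have "\<gamma> + (- \<gamma> - int n) = - int n" by simp
    then show ?thesis
      unfolding padic_norm_p_powi_mult_le_iff
      by (simp only: padic_norm_of_int_le_iff sum_digits_diff_dvd[OF l(1)])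
  qed
  finally have "padic_norm (S l - S n) \<le> real CARD('p) powi (- \<gamma> - int n)" .
  then have "padic_norm (x - S n) \<le> real CARD('p) powi (- \<gamma> - int n)"
    by (rule padic_norm_diff_le_trans[rotated]) (use l(2) padic_norm_minus_commute[of x "S l"] in simp)
  then show ?thesis by (simp add: S_def)
qed

text \<open>After scaling x to norm 1, its approximations modulo p^k form a compatible sequence of
  residues; consecutive ones differ by one digit.\<close>

lemma padic_expansion_exists:
  fixes x :: "'p::prime_card padic"
  assumes "x \<notin> padic_int"
  obtains \<gamma> d where "\<gamma> < 0" "padic_expansion x \<gamma> d"
proof -
  have x: "padic_norm x > 1" using assms by (simp add: padic_int_def)
  then have "x \<noteq> 0" by auto
  then obtain n where n: "padic_norm x = real CARD('p) powi n" by (rule padic_norm_eq_powi)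
  have n_pos: "n > 0" using x n CARD_powi_le_1_iff[where 'p = 'p, of n] by linarith
  define y where "y = padic_p powi n * x"
  have xy: "x = padic_p powi (- n) * y"
    by (simp add: y_def power_int_minus)
  have y: "padic_norm y = 1"
    using CARD_gt_1[where 'p = 'p]
    by (simp add: y_def padic_norm_mult padic_norm_p_powi n power_int_minus)
  have "\<exists>N < CARD('p) ^ k. padic_norm (y - of_nat N) \<le> real CARD('p) powi (- int k)" for k
    using padic_int_approx[of y k] y by auto
  then obtain N where N: "\<And>k. N k < CARD('p) ^ k"
      "\<And>k. padic_norm (y - of_nat (N k)) \<le> real CARD('p) powi (- int k)"
    by metis
  \<comment> \<open>Compatibility: both sides approximate y modulo p^k and lie below p^k, so they
    coincide.\<close>
  have N_mod: "N (Suc k) mod CARD('p) ^ k = N k" for k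
  proof (rule padic_norm_of_nat_diff_eq[where 'p = 'p])
    show "N (Suc k) mod CARD('p) ^ k < CARD('p) ^ k" by simp
    show "N k < CARD('p) ^ k" by (rule N)
    have "int CARD('p) ^ k dvd int (N (Suc k) mod CARD('p) ^ k) - int (N (Suc k))"
      by (simp add: of_nat_mod mod_eq_dvd_iff[symmetric])
    then have "padic_norm (of_int (int (N (Suc k) mod CARD('p) ^ k) - int (N (Suc k))) :: 'p padic)
        \<le> real CARD('p) powi (- int k)"
      unfolding padic_norm_of_int_le_iff .
    then have "padic_norm (of_nat (N (Suc k) mod CARD('p) ^ k) - of_nat (N (Suc k)) :: 'p padic)
        \<le> real CARD('p) powi (- int k)"
      by simp
    moreover have "padic_norm (of_nat (N (Suc k)) - y) \<le> real CARD('p) powi (- int k)"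
      using order_trans[OF N(2)[of "Suc k"], of "real CARD('p) powi (- int k)"]
      by (simp add: padic_norm_minus_commute[of _ y])
    ultimately show "padic_norm (of_nat (N (Suc k) mod CARD('p) ^ k) - of_nat (N k) :: 'p padic)
        \<le> real CARD('p) powi (- int k)"
      using N(2)[of k] by (meson padic_norm_diff_le_trans)
  qed
  \<comment> \<open>Since N (j+1) is below p^(j+1) and reduces to N j modulo p^j, this quotient is
    the single new digit.\<close>
  define d where "d j = N (Suc j) div CARD('p) ^ j" for j
  have sum_d: "(\<Sum>j<k. d j * CARD('p) ^ j) = N k" for k
  proof (induction k)
    case 0
    show ?case using N(1)[of 0] by simp
  next
    case (Suc k)
    have "N (Suc k) = d k * CARD('p) ^ k + N k"
      unfolding d_def using div_mult_mod_eq[of "N (Suc k)" "CARD('p) ^ k"] by (simp only: N_mod)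
    then show ?case using Suc by simp
  qed
  have "d 0 \<noteq> 0"
  proof
    assume "d 0 = 0"
    then have "N (Suc 0) = 0" by (simp add: d_def)
    then have "padic_norm y \<le> real CARD('p) powi (- 1)" using N(2)[of "Suc 0"] by simp
    then show False using y CARD_powi_less_iff[where 'p = 'p, of "-1" 0] by simp
  qed
  moreover have "d j < CARD('p)" for j
    unfolding d_def using N(1)[of "Suc j"] by (intro less_mult_imp_div_less) simp
  moreover have "(\<lambda>j. padic_p powi (- n) * (of_nat (d j) * padic_p ^ j)) sums x"
  proof -
    have eq: "(\<Sum>j<k. padic_p powi (- n) * (of_nat (d j) * padic_p ^ j))
        = padic_p powi (- n) * (of_nat (N k) :: 'p padic)" for k
      unfolding sum_d[symmetric] by (simp add: sum_distrib_left)
    have "dist (padic_p powi (- n) * of_nat (N k)) x \<le> real CARD('p) powi (n - int k)" for k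
    proof -
      have "padic_norm (padic_p powi (- n) * (y - of_nat (N k))) \<le> real CARD('p) powi (n - int k)"
        unfolding padic_norm_p_powi_mult_le_iff using N(2)[of k] by simp
      then show ?thesis
        by (simp add: dist_padic_def xy padic_norm_minus_commute algebra_simps)
    qed
    then have "(\<lambda>k. padic_p powi (- n) * of_nat (N k)) \<longlonglongrightarrow> x"
      unfolding tendsto_dist_iff[of _ x]
      by (intro tendsto_sandwich[OF _ _ tendsto_const LIMSEQ_CARD_powi[where 'p = 'p, of n]]) auto
    then show ?thesis unfolding sums_def eq .
  qed
  ultimately have "padic_expansion x (- n) d" by (simp add: padic_expansion_def)
  then show thesis using that[of "- n" d] n_pos by simp
qed

text \<open>Eliminates the definite description: any approximating fraction N/p^k in [0,1) is the
  fractional part, without reference to an expansion.\<close>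

lemma padic_frac_eq:
  fixes x :: "'p::prime_card padic"
  assumes N: "N < CARD('p) ^ k" "padic_norm (x - padic_p powi (- int k) * of_nat N) \<le> 1"
  shows "padic_frac x = real N / real CARD('p) ^ k"
proof (cases "x \<in> padic_int")
  case True
  \<comment> \<open>Comparison with the approximation 0/p^0 forces N = 0, in accordance with the
    separate clause for p-adic integers.\<close>
  then have "N * CARD('p) ^ 0 = 0 * CARD('p) ^ k"
    by (intro padic_approx_unique[OF N]) (simp_all add: padic_int_def)
  then show ?thesis using True by (simp add: padic_frac_def)
next
  case False
  \<comment> \<open>Cutting an expansion after its first |\<gamma>| digits leaves an error in Z_p,
    so every expansion produces an approximation M/p^l, hence the same fraction.\<close>
  have eq: "real CARD('p) powi \<gamma> * (\<Sum>j<nat \<bar>\<gamma>\<bar>. real (d j) * real CARD('p) ^ j)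
      = real N / real CARD('p) ^ k"
    if "\<gamma> < 0" "padic_expansion x \<gamma> d" for \<gamma> d
  proof -
    define l where "l = nat \<bar>\<gamma>\<bar>"
    have \<gamma>: "\<gamma> = - int l" using that by (simp add: l_def)
    define M where "M = (\<Sum>j<l. d j * CARD('p) ^ j)"
    have "M < CARD('p) ^ l"
      unfolding M_def using that by (intro sum_digits_less) (simp add: padic_expansion_def)
    moreover have "padic_norm (x - padic_p powi (- int l) * of_nat M) \<le> 1"
      using padic_expansion_approx[OF that(2), of l] by (simp add: M_def \<gamma>)
    ultimately have "N * CARD('p) ^ l = M * CARD('p) ^ k"
      by (rule padic_approx_unique[OF N])
    then have "real N * real CARD('p) ^ l = real M * real CARD('p) ^ k"
      by (simp flip: of_nat_mult of_nat_power)
    moreover have "(\<Sum>j<nat \<bar>\<gamma>\<bar>. real (d j) * real CARD('p) ^ j) = real M"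
      by (simp add: M_def l_def)
    ultimately show ?thesis
      using CARD_gt_1[where 'p = 'p] by (simp add: \<gamma> power_int_minus field_simps)
  qed
  obtain \<gamma> d where "\<gamma> < 0" "padic_expansion x \<gamma> d"
    using padic_expansion_exists[OF False] .
  then have "(THE r. \<exists>\<gamma><0. \<exists>d. padic_expansion x \<gamma> d \<and>
      r = real CARD('p) powi \<gamma> * (\<Sum>j<nat \<bar>\<gamma>\<bar>. real (d j) * real CARD('p) ^ j))
    = real N / real CARD('p) ^ k"
    using eq by (intro the_equality) (metis, metis)
  then show ?thesis using False by (simp add: padic_frac_def)
qed

text \<open>Reducing N modulo p^k moves the approximant by a p-adic integer and the exponent by a
  multiple of 2 pi i. Admitting every natural N is what makes sums and multiples of numerators easy
  to handle below.\<close>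

lemma padic_char_eq:
  fixes x :: "'p::prime_card padic"
  assumes x: "padic_norm (x - padic_p powi (- int k) * of_nat N) \<le> 1"
  shows "padic_char x = exp (2 * of_real pi * \<i> * of_nat N / of_nat (CARD('p) ^ k))"
proof -
  define q where "q = CARD('p) ^ k"
  have q: "q > 0" by (simp add: q_def)
  have "int CARD('p) ^ k dvd int N - int (N mod q)"
    by (simp add: q_def of_nat_mod flip: mod_eq_dvd_iff)
  then have "padic_norm (of_int (int N - int (N mod q)) :: 'p padic) \<le> real CARD('p) powi (- int k)"
    unfolding padic_norm_of_int_le_iff .
  then have "padic_norm (padic_p powi (- int k) * (of_nat N - of_nat (N mod q)) :: 'p padic) \<le> 1"
    unfolding padic_norm_p_powi_mult_le_1_iff by simp
  from padic_norm_add_le[OF x this]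
  have "padic_norm (x - padic_p powi (- int k) * of_nat (N mod q)) \<le> 1"
    by (simp add: algebra_simps)
  then have "padic_frac x = real (N mod q) / real q"
    using padic_frac_eq[of "N mod q" k x] q by (simp add: q_def)
  moreover have "exp (2 * of_real pi * \<i> * of_nat N / of_nat q)
      = exp (2 * of_real pi * \<i> * of_real (real (N mod q) / real q))"
  proof -
    have "real N = real (N mod q) + real (N div q) * real q"
      by (simp flip: of_nat_mult of_nat_add)
    then have eq: "real N / real q = real (N mod q) / real q + real (N div q)"
      using q by (simp add: field_simps)
    have "2 * of_real pi * \<i> * of_nat N / of_nat q = 2 * of_real pi * \<i> * of_real (real N / real q)"
      by simp
    also have "\<dots> = 2 * of_real pi * \<i> * of_real (real (N mod q) / real q)
        + of_nat (N div q) * (2 * of_real pi * \<i>)"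
      unfolding eq of_real_add distrib_left by (simp only: of_real_of_nat_eq mult.commute)
    finally show ?thesis by (simp add: exp_add exp_of_nat_mult)
  qed
  ultimately show ?thesis by (simp add: padic_char_def q_def)
qed

lemma padic_norm_le_powi:
  fixes x :: "'p::prime_card padic"
  obtains k :: nat where "padic_norm x \<le> real CARD('p) powi (int k)"
proof -
  obtain k where "padic_norm x < real CARD('p) ^ k"
    using real_arch_pow[of "real CARD('p)" "padic_norm x"] CARD_gt_1[where 'p = 'p] by auto
  then show thesis using that[of k] by simp
qed

lemma padic_frac_approx:
  fixes x :: "'p::prime_card padic"
  assumes "padic_norm x \<le> real CARD('p) powi (int k)"
  obtains N where "N < CARD('p) ^ k" "padic_norm (x - padic_p powi (- int k) * of_nat N) \<le> 1"
proof -
  define y where "y = padic_p powi (int k) * x"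
  have "padic_norm y \<le> 1"
    unfolding y_def padic_norm_p_powi_mult_le_1_iff by (rule assms)
  then obtain N where N: "N < CARD('p) ^ k" "padic_norm (y - of_nat N) \<le> real CARD('p) powi (- int k)"
    by (rule padic_int_approx)
  have "padic_norm (padic_p powi (- int k) * (y - of_nat N)) \<le> 1"
    unfolding padic_norm_p_powi_mult_le_1_iff by (rule N(2))
  then show thesis using that N(1) by (simp add: y_def power_int_minus algebra_simps)
qed

text \<open>Over a common denominator p^k the numerators add, and their sum may exceed p^k without
  harm by \<open>padic_char_eq\<close>.\<close>

lemma padic_char_add:
  fixes x :: "'p::prime_card padic"
  shows "padic_char (x + y) = padic_char x * padic_char y"
proof -
  obtain i j where ij: "padic_norm x \<le> real CARD('p) powi (int i)" "padic_norm y \<le> real CARD('p) powi (int j)"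
    using padic_norm_le_powi by metis
  define k where "k = max i j"
  have "padic_norm x \<le> real CARD('p) powi (int k)" "padic_norm y \<le> real CARD('p) powi (int k)"
    by (rule order_trans[OF ij(1)] order_trans[OF ij(2)]; simp add: k_def del: power_int_of_nat)+
  then obtain N M where
    N: "padic_norm (x - padic_p powi (- int k) * of_nat N) \<le> 1" and
    M: "padic_norm (y - padic_p powi (- int k) * of_nat M) \<le> 1"
    by (metis padic_frac_approx)
  have "padic_norm (x + y - padic_p powi (- int k) * of_nat (N + M)) \<le> 1"
    using padic_norm_add_le[OF N M] by (simp add: algebra_simps)
  from padic_char_eq[OF this] padic_char_eq[OF N] padic_char_eq[OF M] show ?thesis
    by (simp add: algebra_simps add_divide_distrib flip: exp_add)
qed

lemma padic_char_padic_int: "padic_norm x \<le> 1 \<Longrightarrow> padic_char x = 1"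
  by (simp add: padic_char_def padic_frac_def padic_int_def)

lemma padic_char_cong:
  assumes "padic_norm (x - y) \<le> 1"
  shows "padic_char x = padic_char y"
  using padic_char_add[of "x - y" y] padic_char_padic_int[OF assms] by simp

lemma norm_padic_char [simp]: "cmod (padic_char x) = 1"
  by (simp add: padic_char_def norm_exp_eq_Re)

lemma padic_char_minus: "padic_char (- x) = cnj (padic_char x)"
proof -
  have "padic_char (- x) * padic_char x = 1"
    by (simp add: padic_char_padic_int flip: padic_char_add)
  moreover have "cnj (padic_char x) * padic_char x = 1"
    using complex_norm_square[of "padic_char x"] by (simp add: mult.commute)
  ultimately show ?thesis
    by (metis mult_cancel_right mult_zero_right zero_neq_one)
qed

text \<open>The value is exp(2 pi i / p). It is the source of nontriviality in the orthogonality
  argument.\<close>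

lemma padic_char_inverse_p_neq_1: "padic_char (padic_p powi (- 1) :: 'p::prime_card padic) \<noteq> 1"
  using padic_char_eq[where 'p = 'p, of "padic_p powi (- 1)" 1 1]
    complex_root_unity_eq_1[of "CARD('p)" 1] CARD_gt_1[where 'p = 'p]
  by simp

lemma sum_roots_of_unity:
  assumes "q > 0"
  shows "(\<Sum>N<q. exp (2 * of_real pi * \<i> * of_nat (N * M) / of_nat q))
    = (if q dvd M then of_nat q else 0)"
proof -
  define z where "z = exp (2 * of_real pi * \<i> * of_nat M / of_nat q)"
  have pow: "exp (2 * of_real pi * \<i> * of_nat (N * M) / of_nat q) = z ^ N" for N
    unfolding z_def by (simp add: algebra_simps flip: exp_of_nat_mult)
  have z1: "z = 1 \<longleftrightarrow> q dvd M"
    unfolding z_def using complex_root_unity_eq_1[of q M] assms by simp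
  have "z ^ q = exp (of_nat M * (2 * of_real pi * \<i>))"
    using assms unfolding z_def by (simp add: ac_simps flip: exp_of_nat_mult)
  also have "\<dots> = 1" by (simp add: exp_of_nat_mult)
  finally show ?thesis
    unfolding pow using z1 by (cases "z = 1") (simp_all add: geometric_sum)
qed

section \<open>The index sets\<close>

text \<open>Digit lists of length n are the base-p representations of the naturals below p^n, so
  numerators can replace digits throughout.\<close>

lemma padic_digits_eq:
  "{padic_p powi i * (\<Sum>j<n. of_nat (a j) * padic_p ^ j) | a. \<forall>j<n. a j < CARD('p)}
    = (\<lambda>N. padic_p powi i * of_nat N :: 'p::prime_card padic) ` {..<CARD('p) ^ n}" (is "?L = ?R")
proof (intro equalityI subsetI)
  fix x assume "x \<in> ?L"
  then obtain a where a: "\<forall>j<n. a j < CARD('p)"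
    "x = padic_p powi i * of_nat (\<Sum>j<n. a j * CARD('p) ^ j)" by auto
  then show "x \<in> ?R" using sum_digits_less[of n a "CARD('p)"] by blast
next
  fix x assume "x \<in> ?R"
  then obtain N where N: "N < CARD('p) ^ n" "x = padic_p powi i * of_nat N" by auto
  define a where "a j = N div CARD('p) ^ j mod CARD('p)" for j
  have "(\<Sum>j<n. a j * CARD('p) ^ j) = N"
    unfolding a_def sum_digits_eq using N(1) by simp
  then have "x = padic_p powi i * of_nat (\<Sum>j<n. a j * CARD('p) ^ j)" using N(2) by simp
  moreover have "\<forall>j<n. a j < CARD('p)" by (simp add: a_def)
  ultimately show "x \<in> ?L" by auto
qed

lemma I_set_eq:
  "I_set = (\<Union>k\<in>{1..}. (\<lambda>N. padic_p powi (- int k) * of_nat N :: 'p::prime_card padic) ` {..<CARD('p) ^ k})"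
  unfolding I_set_def padic_digits_eq[symmetric] by auto

lemma J_set_eq:
  assumes "m \<ge> 1"
  shows "J_set m = (\<lambda>N. padic_p powi (- int m) * of_nat N :: 'p::prime_card padic)
    ` {N. N < CARD('p) ^ m \<and> \<not> CARD('p) dvd N}" (is "?L = ?R")
proof (intro equalityI subsetI)
  \<comment> \<open>Modulo p only the digit with index 0 survives, and it is present because m is
    positive; hence a nonzero leading digit means a numerator prime to p.\<close>
  have mod_p: "(\<Sum>j<m. s j * CARD('p) ^ j) mod CARD('p) = s 0 mod CARD('p)" for s
  proof -
    have "(\<Sum>j<m. s j * CARD('p) ^ j) = s 0 + (\<Sum>j\<in>{..<m} - {0}. s j * CARD('p) ^ j)"
      using assms by (subst sum.remove[of _ 0]) auto
    moreover have "CARD('p) dvd (\<Sum>j\<in>{..<m} - {0}. s j * CARD('p) ^ j)"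
      by (intro dvd_sum) auto
    ultimately show ?thesis by (auto elim!: dvdE)
  qed
  {
    fix x :: "'p padic" assume "x \<in> ?L"
    then obtain s where s: "\<forall>j<m. s j < CARD('p)" "s 0 \<noteq> 0"
      "x = padic_p powi (- int m) * of_nat (\<Sum>j<m. s j * CARD('p) ^ j)" by (auto simp: J_set_def)
    moreover have "\<not> CARD('p) dvd (\<Sum>j<m. s j * CARD('p) ^ j)"
      using mod_p[of s] s(1,2) assms by (simp add: dvd_eq_mod_eq_0)
    ultimately show "x \<in> ?R" using sum_digits_less[of m s "CARD('p)"] by blast
  next
    fix x :: "'p padic" assume "x \<in> ?R"
    then obtain N where N: "N < CARD('p) ^ m" "\<not> CARD('p) dvd N"
      "x = padic_p powi (- int m) * of_nat N" by auto
    define a where "a j = N div CARD('p) ^ j mod CARD('p)" for j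
    have "(\<Sum>j<m. a j * CARD('p) ^ j) = N"
      unfolding a_def sum_digits_eq using N(1) by simp
    then have "x = padic_p powi (- int m) * of_nat (\<Sum>j<m. a j * CARD('p) ^ j)" using N(3) by simp
    moreover have "\<forall>j<m. a j < CARD('p)" "a 0 \<noteq> 0"
      using N(2) by (simp_all add: a_def dvd_eq_mod_eq_0)
    ultimately show "x \<in> ?L" by (auto simp: J_set_def)
  }
qed

text \<open>Lets \<open>I_set_unique\<close> apply to frequencies: distinct s and t differ by more
  than a p-adic integer.\<close>

lemma J_set_subset_I_set: "m \<ge> 1 \<Longrightarrow> J_set m \<subseteq> I_set"
  unfolding I_set_eq J_set_eq by auto

lemma padic_norm_J_set:
  assumes "m \<ge> 1" "s \<in> J_set m"
  shows "padic_norm (s :: 'p::prime_card padic) = real CARD('p) powi int m"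
proof -
  obtain N where N: "\<not> CARD('p) dvd N" "s = padic_p powi (- int m) * of_nat N"
    using assms unfolding J_set_eq[OF assms(1)] by auto
  have "N \<noteq> 0" using N(1) by (intro notI) simp
  moreover have "multiplicity (int CARD('p)) (int N) = 0"
    using N(1) by (intro not_dvd_imp_multiplicity_0) simp
  ultimately have "padic_norm (of_nat N :: 'p padic) = 1"
    using padic_norm_of_int_eq[where 'p = 'p, of "int N"] by simp
  then show ?thesis using N(2) by (simp add: padic_norm_mult padic_norm_p_powi)
qed

lemma I_set_unique:
  fixes a b :: "'p::prime_card padic"
  assumes "a \<in> I_set" "b \<in> I_set" "padic_norm (a - b) \<le> 1"
  shows "a = b"
proof -
  obtain k N where N: "N < CARD('p) ^ k" "a = padic_p powi (- int k) * of_nat N"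
    using assms(1) unfolding I_set_eq by auto
  obtain l M where M: "M < CARD('p) ^ l" "b = padic_p powi (- int l) * of_nat M"
    using assms(2) unfolding I_set_eq by auto
  have "N * CARD('p) ^ l = M * CARD('p) ^ k"
    using assms(3) N M by (intro padic_approx_unique[of N k a M l]) auto
  then have "(of_nat N * padic_p ^ l :: 'p padic) = of_nat M * padic_p ^ k"
    by (metis of_nat_mult of_nat_power)
  then show ?thesis
    by (simp add: N(2) M(2) power_int_minus field_simps)
qed

text \<open>Together with \<open>I_set_unique\<close> this makes \<open>I_set\<close> a transversal
  of Q_p/Z_p.\<close>

lemma I_set_approx:
  fixes x :: "'p::prime_card padic"
  obtains a where "a \<in> I_set" "padic_norm (x - a) \<le> 1"
proof -
  obtain k where k: "padic_norm x \<le> real CARD('p) powi (int k)" by (rule padic_norm_le_powi)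
  \<comment> \<open>The exponent is raised by one because \<open>I_set\<close> admits only positive
    exponents.\<close>
  also have "\<dots> \<le> real CARD('p) powi (int (Suc k))" by (simp del: power_int_of_nat)
  finally obtain N where "N < CARD('p) ^ Suc k"
    "padic_norm (x - padic_p powi (- int (Suc k)) * of_nat N) \<le> 1"
    by (rule padic_frac_approx)
  moreover from this have "padic_p powi (- int (Suc k)) * (of_nat N :: 'p padic) \<in> I_set"
    unfolding I_set_eq by (intro UN_I[of "Suc k"] imageI) auto
  ultimately show thesis using that by blast
qed

lemma countable_I_set: "countable (I_set :: 'p::prime_card padic set)"
  unfolding I_set_eq by (intro countable_UN countable_image) auto

lemma inj_padic_p_powi_mult_of_nat:
  "inj (\<lambda>N. padic_p powi i * of_nat N :: 'p::prime_card padic)"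
proof (rule injI)
  fix M N assume "padic_p powi i * of_nat M = (padic_p powi i * of_nat N :: 'p padic)"
  then have eq: "of_nat M = (of_nat N :: 'p padic)" by simp
  have "1 < real CARD('p)" using CARD_gt_1[where 'p = 'p] by simp
  from real_arch_pow[OF this] obtain k where "real (max M N) < real CARD('p) ^ k" by blast
  then have "max M N < CARD('p) ^ k"
    by (simp only: of_nat_less_iff flip: of_nat_power)
  then show "M = N"
    using eq by (intro padic_norm_of_nat_diff_eq[where 'p = 'p]) auto
qed

lemma finite_J_set: "m \<ge> 1 \<Longrightarrow> finite (J_set m)"
  unfolding J_set_eq by simp

text \<open>This is the Ramanujan sum for the modulus p^(l+1): the complete character sum minus the
  part over multiples of p, each evaluated by orthogonality of roots of unity.\<close>

lemma sum_padic_char_J_set: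
  fixes y :: "'p::prime_card padic"
  assumes y: "padic_norm y \<le> 1"
  shows "(\<Sum>s\<in>J_set (Suc l). padic_char (s * y))
    = (if padic_norm y \<le> real CARD('p) powi (- int (Suc l)) then of_nat (CARD('p) ^ Suc l) else 0)
      - (if padic_norm y \<le> real CARD('p) powi (- int l) then of_nat (CARD('p) ^ l) else 0)"
proof -
  let ?p = "CARD('p)"
  obtain M where M: "padic_norm (y - of_nat M) \<le> real ?p powi (- int (Suc l))"
    using padic_int_approx[OF y] by blast
  \<comment> \<open>M represents y modulo p^(l+1), so up to that accuracy the norm of y and the
    divisibility of M by powers of p carry the same information.\<close>
  have dvd: "?p ^ k dvd M \<longleftrightarrow> padic_norm y \<le> real ?p powi (- int k)" if "k \<le> Suc l" for k
  proof -
    have "padic_norm (y - of_nat M) \<le> real ?p powi (- int k)"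
      using that by (intro order_trans[OF M]) simp
    then have "padic_norm y \<le> real ?p powi (- int k) \<longleftrightarrow>
        padic_norm (of_int (int M) :: 'p padic) \<le> real ?p powi (- int k)"
      using padic_norm_diff_le[of y _ "y - of_nat M"] padic_norm_add_le[of "y - of_nat M" _ "of_nat M"]
      by auto
    also have "\<dots> \<longleftrightarrow> int (?p ^ k) dvd int M"
      unfolding padic_norm_of_int_le_iff by simp
    finally show ?thesis by (simp only: int_dvd_int_iff)
  qed
  define e where "e N = exp (2 * of_real pi * \<i> * of_nat (N * M) / of_nat (?p ^ Suc l))" for N
  have char: "padic_char (padic_p powi (- int (Suc l)) * of_nat N * y) = e N" for N
    unfolding e_def
  proof (rule padic_char_eq)
    have "padic_norm (of_nat N * (y - of_nat M)) \<le> real ?p powi (- int (Suc l))"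
      unfolding padic_norm_mult
      by (rule order_trans[OF mult_left_le_one_le M])
        (simp_all add: padic_norm_nonneg)
    then have "padic_norm (padic_p powi (- int (Suc l)) * (of_nat N * (y - of_nat M))) \<le> 1"
      unfolding padic_norm_p_powi_mult_le_1_iff .
    then show "padic_norm (padic_p powi (- int (Suc l)) * of_nat N * y
        - padic_p powi (- int (Suc l)) * of_nat (N * M)) \<le> 1"
      by (simp add: algebra_simps)
  qed
  have "(\<Sum>s\<in>J_set (Suc l). padic_char (s * y)) = (\<Sum>N | N < ?p ^ Suc l \<and> \<not> ?p dvd N. e N)"
  proof -
    have "J_set (Suc l) = (\<lambda>N. padic_p powi (- int (Suc l)) * of_nat N :: 'p padic)
        ` {N. N < ?p ^ Suc l \<and> \<not> ?p dvd N}"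
      by (rule J_set_eq) simp
    then show ?thesis
      by (simp only: sum.reindex[OF inj_on_subset[OF inj_padic_p_powi_mult_of_nat subset_UNIV]]
          o_def char)
  qed
  \<comment> \<open>The removed numerators are p N with N < p^l, and p N / p^(l+1) = N / p^l makes
    theirs the complete sum for the modulus p^l.\<close>
  also have "{N. N < ?p ^ Suc l \<and> \<not> ?p dvd N} = {..<?p ^ Suc l} - (\<lambda>N. ?p * N) ` {..<?p ^ l}"
    by (auto simp: dvd_def)
  also have "(\<Sum>N\<in>\<dots>. e N) = (\<Sum>N<?p ^ Suc l. e N) - (\<Sum>N\<in>(\<lambda>N. ?p * N) ` {..<?p ^ l}. e N)"
    by (intro sum_diff) auto
  also have "(\<Sum>N\<in>(\<lambda>N. ?p * N) ` {..<?p ^ l}. e N)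
      = (\<Sum>N<?p ^ l. exp (2 * of_real pi * \<i> * of_nat (N * M) / of_nat (?p ^ l)))"
    by (subst sum.reindex) (auto simp: inj_on_def e_def field_simps)
  also have "\<dots> = (if ?p ^ l dvd M then of_nat (?p ^ l) else 0)"
    by (intro sum_roots_of_unity) simp
  also have "(\<Sum>N<?p ^ Suc l. e N) = (if ?p ^ Suc l dvd M then of_nat (?p ^ Suc l) else 0)"
    unfolding e_def by (intro sum_roots_of_unity) simp
  finally show ?thesis unfolding dvd[OF order_refl] dvd[OF le_SucI[OF order_refl]] .
qed

section \<open>Functions approximable in mean square\<close>

lemma L2I:
  assumes "f \<in> borel_measurable M" "integrable M h" "\<And>x. x \<in> space M \<Longrightarrow> (cmod (f x))\<^sup>2 \<le> h x"
  shows "f \<in> L2 M"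
proof -
  have "integrable M (\<lambda>x. (cmod (f x))\<^sup>2)"
  proof (rule Bochner_Integration.integrable_bound[OF assms(2)])
    show "AE x in M. norm ((cmod (f x))\<^sup>2) \<le> norm (h x)"
      using assms(3) by (intro AE_I2) (metis abs_ge_self order_trans real_norm_def abs_of_nonneg zero_le_power2)
  qed (use assms(1) in measurable)
  then show ?thesis using assms(1) by (simp add: L2_def)
qed

lemma L2_measurable: "f \<in> L2 M \<Longrightarrow> f \<in> borel_measurable M"
  and L2_integrable: "f \<in> L2 M \<Longrightarrow> integrable M (\<lambda>x. (cmod (f x))\<^sup>2)"
  by (simp_all add: L2_def)

text \<open>Takes the place of the Minkowski inequality; the factor 2 is harmless because errors
  only have to become arbitrarily small.\<close>

lemma cmod_add_squared_le: "(cmod (a + b))\<^sup>2 \<le> 2 * (cmod a)\<^sup>2 + 2 * (cmod b)\<^sup>2"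
proof -
  have "(cmod (a + b))\<^sup>2 \<le> (cmod a + cmod b)\<^sup>2"
    by (intro power_mono norm_triangle_ineq) simp
  also have "\<dots> \<le> 2 * (cmod a)\<^sup>2 + 2 * (cmod b)\<^sup>2"
    using zero_le_power2[of "cmod a - cmod b"] by (simp add: power2_eq_square algebra_simps)
  finally show ?thesis .
qed

lemma L2_add:
  assumes f: "f \<in> L2 M" and g: "g \<in> L2 M"
  shows "(\<lambda>x. f x + g x) \<in> L2 M"
    and "(LINT x|M. (cmod (f x + g x))\<^sup>2) \<le> 2 * (LINT x|M. (cmod (f x))\<^sup>2) + 2 * (LINT x|M. (cmod (g x))\<^sup>2)"
proof -
  note [measurable] = f[THEN L2_measurable] g[THEN L2_measurable]
  have int: "integrable M (\<lambda>x. 2 * (cmod (f x))\<^sup>2 + 2 * (cmod (g x))\<^sup>2)"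
    using f[THEN L2_integrable] g[THEN L2_integrable] by simp
  show fg: "(\<lambda>x. f x + g x) \<in> L2 M"
    by (rule L2I[OF _ int]) (simp_all add: cmod_add_squared_le)
  have "(LINT x|M. (cmod (f x + g x))\<^sup>2) \<le> (LINT x|M. 2 * (cmod (f x))\<^sup>2 + 2 * (cmod (g x))\<^sup>2)"
    by (intro integral_mono L2_integrable[OF fg] int cmod_add_squared_le)
  then show "(LINT x|M. (cmod (f x + g x))\<^sup>2) \<le> 2 * (LINT x|M. (cmod (f x))\<^sup>2) + 2 * (LINT x|M. (cmod (g x))\<^sup>2)"
    using f[THEN L2_integrable] g[THEN L2_integrable] by simp
qed

lemma L2_scale: "f \<in> L2 M \<Longrightarrow> (\<lambda>x. c * f x) \<in> L2 M"
  by (auto simp: L2_def norm_mult power_mult_distrib intro: borel_measurable_times)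

lemma L2_diff: "f \<in> L2 M \<Longrightarrow> g \<in> L2 M \<Longrightarrow> (\<lambda>x. f x - g x) \<in> L2 M"
  using L2_add(1)[of f M "\<lambda>x. (- 1) * g x"] L2_scale[of g M "- 1"] by simp

lemma L2_sum:
  assumes "\<And>i. i \<in> F \<Longrightarrow> f i \<in> L2 M"
  shows "(\<lambda>x. \<Sum>i\<in>F. f i x) \<in> L2 M"
  using assms
proof (induction F rule: infinite_finite_induct)
  case (insert i F)
  then show ?case by (simp add: L2_add)
qed (simp_all add: L2_def)

text \<open>Squared distances give the same closure as the norm and avoid square roots. Membership
  in \<open>L2\<close> is demanded explicitly because the integral of a non-integrable function is 0
  by convention, which would otherwise count as a small distance.\<close>

definition L2_closed_span :: "'a measure \<Rightarrow> 'i set \<Rightarrow> ('i \<Rightarrow> 'a \<Rightarrow> complex) \<Rightarrow> ('a \<Rightarrow> complex) set" where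
  "L2_closed_span M I \<theta> = {f \<in> L2 M. \<forall>e>0. \<exists>F c. finite F \<and> F \<subseteq> I \<and>
     (LINT x|M. (cmod (f x - (\<Sum>i\<in>F. c i * \<theta> i x)))\<^sup>2) < e}"

locale L2_family =
  fixes M :: "'a measure" and I :: "'i set" and \<theta> :: "'i \<Rightarrow> 'a \<Rightarrow> complex"
  assumes \<theta>_L2: "i \<in> I \<Longrightarrow> \<theta> i \<in> L2 M"
begin

abbreviation "W \<equiv> L2_closed_span M I \<theta>"

lemma W_L2: "f \<in> W \<Longrightarrow> f \<in> L2 M"
  by (simp add: L2_closed_span_def)

lemma W_approx:
  assumes "f \<in> W" "e > 0"
  obtains F c where "finite F" "F \<subseteq> I" "(LINT x|M. (cmod (f x - (\<Sum>i\<in>F. c i * \<theta> i x)))\<^sup>2) < e"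
  using assms unfolding L2_closed_span_def by blast

lemma combination_L2: "F \<subseteq> I \<Longrightarrow> (\<lambda>x. \<Sum>i\<in>F. c i * \<theta> i x) \<in> L2 M"
  by (intro L2_sum L2_scale \<theta>_L2) auto

lemma W_combination:
  assumes "finite F" "F \<subseteq> I"
  shows "(\<lambda>x. \<Sum>i\<in>F. c i * \<theta> i x) \<in> W"
proof -
  have "(LINT x|M. (cmod ((\<Sum>i\<in>F. c i * \<theta> i x) - (\<Sum>i\<in>F. c i * \<theta> i x)))\<^sup>2) < e" if "e > 0" for e :: real
    using that by simp
  then show ?thesis
    using assms combination_L2[OF assms(2)] unfolding L2_closed_span_def by blast
qed

lemma W_zero: "(\<lambda>x. 0) \<in> W"
  using W_combination[of "{}"] by simp

lemma W_closed:
  assumes f: "f \<in> L2 M" and "\<And>e. e > 0 \<Longrightarrow> \<exists>g\<in>W. (LINT x|M. (cmod (f x - g x))\<^sup>2) < e"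
  shows "f \<in> W"
proof -
  have "\<exists>F c. finite F \<and> F \<subseteq> I \<and> (LINT x|M. (cmod (f x - (\<Sum>i\<in>F. c i * \<theta> i x)))\<^sup>2) < e"
    if e: "e > 0" for e :: real
  proof -
    \<comment> \<open>A quarter each, since the bound for sums doubles both squared errors.\<close>
    obtain g where g: "g \<in> W" "(LINT x|M. (cmod (f x - g x))\<^sup>2) < e / 4"
      using assms(2)[of "e / 4"] e by auto
    obtain F c where F: "finite F" "F \<subseteq> I"
      and c: "(LINT x|M. (cmod (g x - (\<Sum>i\<in>F. c i * \<theta> i x)))\<^sup>2) < e / 4"
      using W_approx[OF g(1), of "e / 4"] e by auto
    have "(LINT x|M. (cmod (f x - (\<Sum>i\<in>F. c i * \<theta> i x)))\<^sup>2)
        = (LINT x|M. (cmod ((f x - g x) + (g x - (\<Sum>i\<in>F. c i * \<theta> i x))))\<^sup>2)"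
      by simp
    also have "\<dots> \<le> 2 * (LINT x|M. (cmod (f x - g x))\<^sup>2)
        + 2 * (LINT x|M. (cmod (g x - (\<Sum>i\<in>F. c i * \<theta> i x)))\<^sup>2)"
      by (intro L2_add(2) L2_diff f W_L2[OF g(1)] combination_L2 F)
    also have "\<dots> < e" using g(2) c by simp
    finally show ?thesis using F by blast
  qed
  then show ?thesis using f by (simp add: L2_closed_span_def)
qed

lemma W_scale:
  assumes "f \<in> W"
  shows "(\<lambda>x. k * f x) \<in> W"
proof -
  have "\<exists>F c. finite F \<and> F \<subseteq> I \<and> (LINT x|M. (cmod (k * f x - (\<Sum>i\<in>F. c i * \<theta> i x)))\<^sup>2) < e"
    if e: "e > 0" for e :: real
  proof -
    define r where "r = (cmod k)\<^sup>2"
    have r: "r \<ge> 0" by (simp add: r_def)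
    \<comment> \<open>The summand 1 keeps the denominator positive when k is 0.\<close>
    obtain F c where F: "finite F" "F \<subseteq> I"
      and c: "(LINT x|M. (cmod (f x - (\<Sum>i\<in>F. c i * \<theta> i x)))\<^sup>2) < e / (r + 1)"
      using W_approx[OF assms, of "e / (r + 1)"] e r by auto
    have eq: "(cmod (k * f x - (\<Sum>i\<in>F. k * c i * \<theta> i x)))\<^sup>2
        = r * (cmod (f x - (\<Sum>i\<in>F. c i * \<theta> i x)))\<^sup>2" for x
    proof -
      have "k * f x - (\<Sum>i\<in>F. k * c i * \<theta> i x) = k * (f x - (\<Sum>i\<in>F. c i * \<theta> i x))"
        by (simp add: sum_distrib_left right_diff_distrib mult.assoc)
      then show ?thesis by (simp add: r_def norm_mult power_mult_distrib)
    qed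
    have "r * (LINT x|M. (cmod (f x - (\<Sum>i\<in>F. c i * \<theta> i x)))\<^sup>2) \<le> r * (e / (r + 1))"
      using c r by (intro mult_left_mono) auto
    also have "\<dots> < e" using e r by (simp add: field_simps)
    finally have "(LINT x|M. (cmod (k * f x - (\<Sum>i\<in>F. k * c i * \<theta> i x)))\<^sup>2) < e"
      unfolding eq by simp
    then show ?thesis using F by (intro exI[of _ F] exI[of _ "\<lambda>i. k * c i"]) simp
  qed
  then show ?thesis using L2_scale[OF W_L2[OF assms]] by (simp add: L2_closed_span_def)
qed

lemma W_add:
  assumes f: "f \<in> W" and g: "g \<in> W"
  shows "(\<lambda>x. f x + g x) \<in> W"
proof (rule W_closed)
  show "(\<lambda>x. f x + g x) \<in> L2 M" by (intro L2_add W_L2 f g)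
  fix e :: real assume e: "e > 0"
  obtain F c where F: "finite F" "F \<subseteq> I"
    and c: "(LINT x|M. (cmod (f x - (\<Sum>i\<in>F. c i * \<theta> i x)))\<^sup>2) < e / 4"
    using W_approx[OF f, of "e / 4"] e by auto
  obtain G d where G: "finite G" "G \<subseteq> I"
    and d: "(LINT x|M. (cmod (g x - (\<Sum>i\<in>G. d i * \<theta> i x)))\<^sup>2) < e / 4"
    using W_approx[OF g, of "e / 4"] e by auto
  define b where "b i = (if i \<in> F then c i else 0) + (if i \<in> G then d i else 0)" for i
  have b: "(\<Sum>i\<in>F \<union> G. b i * \<theta> i x) = (\<Sum>i\<in>F. c i * \<theta> i x) + (\<Sum>i\<in>G. d i * \<theta> i x)" for x
  proof -
    have "(\<Sum>i\<in>F. c i * \<theta> i x) = (\<Sum>i\<in>F \<union> G. (if i \<in> F then c i else 0) * \<theta> i x)"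
      by (rule sum.mono_neutral_cong_left) (use F G in auto)
    moreover have "(\<Sum>i\<in>G. d i * \<theta> i x) = (\<Sum>i\<in>F \<union> G. (if i \<in> G then d i else 0) * \<theta> i x)"
      by (rule sum.mono_neutral_cong_left) (use F G in auto)
    ultimately show ?thesis by (simp only: b_def distrib_right sum.distrib)
  qed
  have "(LINT x|M. (cmod (f x + g x - (\<Sum>i\<in>F \<union> G. b i * \<theta> i x)))\<^sup>2)
      = (LINT x|M. (cmod ((f x - (\<Sum>i\<in>F. c i * \<theta> i x)) + (g x - (\<Sum>i\<in>G. d i * \<theta> i x))))\<^sup>2)"
    unfolding b by (simp only: add_diff_add)
  also have "\<dots> \<le> 2 * (LINT x|M. (cmod (f x - (\<Sum>i\<in>F. c i * \<theta> i x)))\<^sup>2)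
      + 2 * (LINT x|M. (cmod (g x - (\<Sum>i\<in>G. d i * \<theta> i x)))\<^sup>2)"
    by (intro L2_add(2) L2_diff W_L2 f g combination_L2 F G)
  also have "\<dots> < e" using c d by simp
  finally show "\<exists>h\<in>W. (LINT x|M. (cmod (f x + g x - h x))\<^sup>2) < e"
    using F G by (intro bexI[OF _ W_combination[of "F \<union> G" b]]) auto
qed

lemma W_diff: "f \<in> W \<Longrightarrow> g \<in> W \<Longrightarrow> (\<lambda>x. f x - g x) \<in> W"
  using W_add[of f "\<lambda>x. (- 1) * g x"] W_scale[of g "- 1"] by simp

lemma W_sum:
  assumes "\<And>i. i \<in> F \<Longrightarrow> f i \<in> W"
  shows "(\<lambda>x. \<Sum>i\<in>F. f i x) \<in> W"
  using assms by (induction F rule: infinite_finite_induct) (simp_all add: W_zero W_add)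

text \<open>Both f and every g n are bounded by h, so 4 h^2 dominates the squared differences, and
  dominated convergence gives convergence in mean square. It serves twice: for countable disjoint
  unions and for approximation by simple functions.\<close>

lemma W_dominated_limit:
  assumes g: "\<And>n. g n \<in> W" and h: "integrable M (\<lambda>x. (h x)\<^sup>2)"
    and bound: "\<And>n x. x \<in> space M \<Longrightarrow> cmod (g n x) \<le> h x"
    and lim: "\<And>x. x \<in> space M \<Longrightarrow> (\<lambda>n. g n x) \<longlonglongrightarrow> f x"
  shows "f \<in> W"
proof (rule W_closed)
  have [measurable]: "g n \<in> borel_measurable M" for n
    by (intro L2_measurable W_L2 g)
  have f[measurable]: "f \<in> borel_measurable M"
    by (rule borel_measurable_LIMSEQ_metric[OF _ lim]) measurable
  have f_le: "cmod (f x) \<le> h x" if "x \<in> space M" for x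
    using tendsto_norm[OF lim[OF that]] bound[OF that] by (intro LIMSEQ_le_const2) auto
  show "f \<in> L2 M"
    using f_le by (intro L2I[OF f h] power_mono) auto
  have "(\<lambda>n. LINT x|M. (cmod (f x - g n x))\<^sup>2) \<longlonglongrightarrow> (LINT x|M. 0)"
  proof (rule integral_dominated_convergence)
    show "integrable M (\<lambda>x. 4 * (h x)\<^sup>2)" using h by simp
    show "AE x in M. (\<lambda>n. (cmod (f x - g n x))\<^sup>2) \<longlonglongrightarrow> 0"
    proof (rule AE_I2)
      fix x assume "x \<in> space M"
      then have "(\<lambda>n. f x - g n x) \<longlonglongrightarrow> f x - f x"
        by (intro tendsto_diff tendsto_const lim)
      then have "(\<lambda>n. (cmod (f x - g n x))\<^sup>2) \<longlonglongrightarrow> (cmod (f x - f x))\<^sup>2"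
        by (intro tendsto_power tendsto_norm)
      then show "(\<lambda>n. (cmod (f x - g n x))\<^sup>2) \<longlonglongrightarrow> 0" by simp
    qed
    show "AE x in M. norm ((cmod (f x - g n x))\<^sup>2) \<le> 4 * (h x)\<^sup>2" for n
    proof (rule AE_I2)
      fix x assume x: "x \<in> space M"
      have "cmod (f x - g n x) \<le> 2 * h x"
        using norm_triangle_ineq4[of "f x" "g n x"] f_le[OF x] bound[OF x, of n] by simp
      then have "(cmod (f x - g n x))\<^sup>2 \<le> (2 * h x)\<^sup>2"
        by (rule power_mono) simp
      then show "norm ((cmod (f x - g n x))\<^sup>2) \<le> 4 * (h x)\<^sup>2"
        by (simp add: power_mult_distrib)
    qed
  qed measurable
  then have lim0: "(\<lambda>n. LINT x|M. (cmod (f x - g n x))\<^sup>2) \<longlonglongrightarrow> 0" by simp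
  fix e :: real assume "e > 0"
  then obtain n where "(LINT x|M. (cmod (f x - g n x))\<^sup>2) < e"
    using order_tendstoD(2)[OF lim0] by (auto simp: eventually_sequentially)
  then show "\<exists>g\<in>W. (LINT x|M. (cmod (f x - g x))\<^sup>2) < e" using g by blast
qed

end

section \<open>Balls and the Haar measure\<close>

definition padic_ball :: "int \<Rightarrow> 'p::prime_card padic \<Rightarrow> 'p padic set" where
  "padic_ball n c = {x. padic_norm (x - c) \<le> real CARD('p) powi n}"

lemma mem_padic_ball: "x \<in> padic_ball n c \<longleftrightarrow> padic_norm (x - c) \<le> real CARD('p) powi n"
  for x :: "'p::prime_card padic"
  by (simp add: padic_ball_def)

lemma padic_ball_subset:
  fixes x c :: "'p::prime_card padic"
  assumes "x \<in> padic_ball n c" "k \<le> n"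
  shows "padic_ball k x \<subseteq> padic_ball n c"
proof
  fix y assume "y \<in> padic_ball k x"
  then have "padic_norm (y - x) \<le> real CARD('p) powi n"
    unfolding mem_padic_ball by (rule order_trans) (use assms(2) in simp)
  then show "y \<in> padic_ball n c"
    using assms(1) unfolding mem_padic_ball by (rule padic_norm_diff_le_trans)
qed

lemma centre_in_padic_ball [simp]: "c \<in> padic_ball n c"
  by (simp add: mem_padic_ball less_imp_le)

lemma padic_ball_eq:
  assumes "x \<in> padic_ball n c"
  shows "padic_ball n x = padic_ball n c"
proof
  show "padic_ball n x \<subseteq> padic_ball n c" using assms by (rule padic_ball_subset) simp
  have "c \<in> padic_ball n x" using assms by (simp add: mem_padic_ball padic_norm_minus_commute)
  then show "padic_ball n c \<subseteq> padic_ball n x" by (rule padic_ball_subset) simp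
qed

text \<open>Every point of a ball is a centre of it, so two balls that meet can be recentred at a
  common point and are then nested.\<close>

lemma padic_ball_Int:
  "padic_ball i a \<inter> padic_ball j b \<in> {{}, padic_ball i a, padic_ball j b}"
proof (cases "padic_ball i a \<inter> padic_ball j b = {}")
  case False
  then obtain x where "x \<in> padic_ball i a" "x \<in> padic_ball j b" by blast
  then have eq: "padic_ball i a = padic_ball i x" "padic_ball j b = padic_ball j x"
    by (simp_all add: padic_ball_eq)
  show ?thesis
  proof (cases "i \<le> j")
    case True
    then have "padic_ball i x \<subseteq> padic_ball j x" by (simp add: padic_ball_subset)
    then show ?thesis unfolding eq by blast
  next
    case False
    then have "padic_ball j x \<subseteq> padic_ball i x" by (simp add: padic_ball_subset)
    then show ?thesis unfolding eq by blast
  qed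
qed simp

text \<open>Constancy on all balls of one fixed radius makes the preimage of every set open.
  Wavelets and characters are both of this kind.\<close>

lemma padic_locally_constant_measurable:
  fixes f :: "'p::prime_card padic \<Rightarrow> 'b::topological_space"
  assumes "\<And>x y. y \<in> padic_ball n x \<Longrightarrow> f y = f x"
  shows "f \<in> borel_measurable borel"
proof (rule borel_measurableI)
  fix S :: "'b set"
  have "open (f -` S)"
    unfolding open_dist
  proof (intro ballI exI conjI allI impI)
    fix x y assume "x \<in> f -` S" "dist y x < real CARD('p) powi n"
    then show "y \<in> f -` S" using assms[of y x] by (simp add: dist_padic_def mem_padic_ball)
  qed simp
  then show "f -` S \<inter> space borel \<in> sets borel" by simp
qed

lemma padic_ball_borel [measurable]: "padic_ball n c \<in> sets borel"
proof (rule borel_open)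
  show "open (padic_ball n c)"
    unfolding open_dist
  proof (intro ballI exI conjI allI impI)
    fix x y assume xy: "x \<in> padic_ball n c" "dist y x < real CARD('a) powi n"
    then have "y \<in> padic_ball n x" by (simp add: dist_padic_def mem_padic_ball)
    then show "y \<in> padic_ball n c" by (simp only: padic_ball_eq[OF xy(1)])
  qed simp
qed

text \<open>Combined with \<open>I_set_approx\<close> it also gives every ball of radius p^\<gamma>
  a centre in the countable set p^(-\<gamma>) \<open>I_set\<close>.\<close>

lemma theta_support_iff:
  "padic_norm (padic_p powi \<gamma> * x - a) \<le> 1 \<longleftrightarrow> x \<in> padic_ball \<gamma> (padic_p powi (- \<gamma>) * a)"
  for x :: "'p::prime_card padic"
proof -
  have "padic_p powi \<gamma> * x - a = padic_p powi \<gamma> * (x - padic_p powi (- \<gamma>) * a)"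
    by (simp add: power_int_minus right_diff_distrib)
  then show ?thesis by (simp only: padic_norm_p_powi_mult_le_1_iff mem_padic_ball)
qed

text \<open>Recentring reduces all balls to countably many, so each open set is a countable union of
  balls.\<close>

lemma sets_borel_padic:
  "sets (borel :: 'p::prime_card padic measure)
    = sigma_sets UNIV (insert {} (range (\<lambda>(n, c). padic_ball n c)))" (is "_ = sigma_sets UNIV ?G")
proof -
  have "S \<in> sigma_sets UNIV ?G" if S: "open S" for S :: "'p padic set"
  proof -
    define K where "K = {(n, a). a \<in> I_set \<and> padic_ball n (padic_p powi (- n) * a) \<subseteq> S}"
    have "S = \<Union>((\<lambda>(n, a). padic_ball n (padic_p powi (- n) * a)) ` K)"
    proof (intro equalityI subsetI)
      fix x assume "x \<in> S"
      then obtain e where e: "e > 0" "\<And>y. dist y x < e \<Longrightarrow> y \<in> S"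
        using S unfolding open_dist by blast
      obtain k where k: "real CARD('p) powi (0 - int k) < e"
        using ex_CARD_powi_less[OF e(1)] by blast
      define n where "n = - int k"
      obtain a where a: "a \<in> I_set" "padic_norm (padic_p powi n * x - a) \<le> 1"
        by (rule I_set_approx)
      then have x: "x \<in> padic_ball n (padic_p powi (- n) * a)"
        by (simp add: theta_support_iff)
      have "padic_ball n x \<subseteq> S"
        using k by (auto simp: mem_padic_ball n_def dist_padic_def intro!: e(2))
      then have "(n, a) \<in> K" using a(1) padic_ball_eq[OF x] by (simp add: K_def)
      then show "x \<in> \<Union>((\<lambda>(n, a). padic_ball n (padic_p powi (- n) * a)) ` K)" using x by blast
    qed (auto simp: K_def)
    also have "\<dots> \<in> sigma_sets UNIV ?G"
    proof (rule sigma_sets_UNION)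
      have "countable (UNIV \<times> I_set :: (int \<times> 'p padic) set)"
        by (intro countable_SIGMA countable_I_set) auto
      then have "countable K" by (rule countable_subset[rotated]) (auto simp: K_def)
      then show "countable ((\<lambda>(n, a). padic_ball n (padic_p powi (- n) * a)) ` K)" by simp
    qed (auto intro!: sigma_sets.Basic)
    finally show ?thesis .
  qed
  moreover have "G \<in> sigma_sets UNIV {S :: 'p padic set. open S}" if "G \<in> ?G" for G
  proof -
    have "G \<in> sets borel" using that by auto
    then show ?thesis by (simp add: borel_def)
  qed
  ultimately have "sigma_sets UNIV {S :: 'p padic set. open S} = sigma_sets UNIV ?G"
    by (intro sigma_sets_eqI) auto
  then show ?thesis by (simp add: borel_def)
qed

section \<open>Translation invariance of the integral and the measure of balls\<close>

locale padic_haar_measure =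
  fixes \<mu> :: "'p::prime_card padic measure"
  assumes haar: "padic_haar \<mu>"
begin

lemma sets_eq [simp, measurable_cong]: "sets \<mu> = sets borel"
  using haar by (simp add: padic_haar_def)

lemma space_eq [simp]: "space \<mu> = UNIV"
  using sets_eq_imp_space_eq[OF sets_eq] by simp

lemma measurable_eq [simp]: "borel_measurable \<mu> = borel_measurable borel"
  by (rule measurable_cong_sets) simp_all

lemma emeasure_translate: "A \<in> sets borel \<Longrightarrow> emeasure \<mu> ((\<lambda>x. a + x) ` A) = emeasure \<mu> A"
  using haar by (simp add: padic_haar_def)

lemma measurable_translate [measurable]: "(\<lambda>x. a + x) \<in> borel \<rightarrow>\<^sub>M (borel :: 'p padic measure)"
proof (rule borel_measurable_continuous_onI)
  have "dist (a + x) (a + y) = dist x y" for x y :: "'p padic"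
    by (simp add: dist_padic_def)
  then show "continuous_on UNIV (\<lambda>x. a + x)"
    by (auto simp: continuous_on_iff)
qed

lemma integral_translate:
  fixes f :: "'p padic \<Rightarrow> complex"
  assumes "f \<in> borel_measurable borel"
  shows "(LINT x|\<mu>. f (a + x)) = (LINT x|\<mu>. f x)"
proof -
  have "distr \<mu> \<mu> (\<lambda>x. a + x) = \<mu>"
  proof (rule measure_eqI)
    fix A assume "A \<in> sets (distr \<mu> \<mu> (\<lambda>x. a + x))"
    then have A: "A \<in> sets borel" by simp
    \<comment> \<open>Invariance is stated for images, whereas the push-forward uses preimages;
      translation by -a turns one into the other.\<close>
    have "(\<lambda>x. a + x) -` A = (\<lambda>x. - a + x) ` A"
      by (auto simp: image_iff intro!: bexI[where x = "a + _"])
    then show "emeasure (distr \<mu> \<mu> (\<lambda>x. a + x)) A = emeasure \<mu> A"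
      using A emeasure_translate[OF A, of "- a"]
      by (subst emeasure_distr) (auto intro: measurable_translate simp: measurable_cong_sets[OF sets_eq sets_eq])
  qed simp
  then show ?thesis
    using assms integral_distr[of "\<lambda>x. a + x" \<mu> \<mu> f]
    by (simp add: measurable_cong_sets[OF sets_eq sets_eq])
qed

lemma emeasure_padic_ball_centre: "emeasure \<mu> (padic_ball n c) = emeasure \<mu> (padic_ball n 0)"
proof -
  have "padic_ball n c = (\<lambda>x. c + x) ` padic_ball n 0"
    by (auto simp: mem_padic_ball image_iff intro!: bexI[where x = "_ - c"])
  then show ?thesis by (simp add: emeasure_translate)
qed

text \<open>The larger ball splits into p translates of the smaller one, according to the residue of
  p^(n+1) x modulo p.\<close>

lemma emeasure_padic_ball_step:
  "emeasure \<mu> (padic_ball (n + 1) 0) = ennreal (real CARD('p)) * emeasure \<mu> (padic_ball n 0)"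
proof -
  define k where "k = n + 1"
  define c where "c i = padic_p powi (- k) * (of_nat i :: 'p padic)" for i
  have ball_iff: "x \<in> padic_ball n (c i) \<longleftrightarrow>
      padic_norm (padic_p powi k * x - of_nat i) \<le> real CARD('p) powi (- int 1)" for x i
  proof -
    have "padic_p powi k * x - of_nat i = padic_p powi k * (x - c i)"
      by (simp add: c_def power_int_minus right_diff_distrib)
    then show ?thesis
      by (simp only: padic_norm_p_powi_mult_le_iff mem_padic_ball) (simp add: k_def)
  qed
  have "padic_ball k 0 = (\<Union>i<CARD('p). padic_ball n (c i))"
  proof (intro equalityI subsetI)
    fix x :: "'p padic" assume "x \<in> padic_ball k 0"
    then have "padic_norm (padic_p powi k * x) \<le> 1"
      unfolding padic_norm_p_powi_mult_le_1_iff by (simp add: mem_padic_ball)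
    then obtain i where "i < CARD('p) ^ 1"
      "padic_norm (padic_p powi k * x - of_nat i) \<le> real CARD('p) powi (- int 1)"
      by (rule padic_int_approx)
    then show "x \<in> (\<Union>i<CARD('p). padic_ball n (c i))" unfolding ball_iff[symmetric] by auto
  next
    fix x :: "'p padic" assume "x \<in> (\<Union>i<CARD('p). padic_ball n (c i))"
    then obtain i where "x \<in> padic_ball n (c i)" by blast
    moreover have "c i \<in> padic_ball k 0"
      unfolding mem_padic_ball c_def diff_0_right padic_norm_p_powi_mult_le_iff by simp
    ultimately show "x \<in> padic_ball k 0" using padic_ball_subset[of "c i" k 0 n] by (auto simp: k_def)
  qed
  moreover have "disjoint_family_on (\<lambda>i. padic_ball n (c i)) {..<CARD('p)}"
    unfolding disjoint_family_on_def
  proof (intro ballI impI, rule ccontr)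
    fix i j assume ij: "i \<in> {..<CARD('p)}" "j \<in> {..<CARD('p)}" "i \<noteq> j"
      "padic_ball n (c i) \<inter> padic_ball n (c j) \<noteq> {}"
    from ij(4) obtain x where x: "x \<in> padic_ball n (c i)" "x \<in> padic_ball n (c j)"
      by (metis disjoint_iff)
    have "padic_norm (of_nat i - of_nat j :: 'p padic) \<le> real CARD('p) powi (- int 1)"
    proof (rule padic_norm_diff_le_trans)
      show "padic_norm (of_nat i - padic_p powi k * x) \<le> real CARD('p) powi (- int 1)"
        using x(1) unfolding ball_iff by (subst padic_norm_minus_commute)
      show "padic_norm (padic_p powi k * x - of_nat j) \<le> real CARD('p) powi (- int 1)"
        using x(2) unfolding ball_iff .
    qed
    then show False using ij padic_norm_of_nat_diff_eq[of i 1 j, where 'p = 'p] by simp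
  qed
  ultimately have "emeasure \<mu> (padic_ball k 0) = (\<Sum>i<CARD('p). emeasure \<mu> (padic_ball n (c i)))"
    by (subst sum_emeasure) auto
  also have "\<dots> = (\<Sum>i<CARD('p). emeasure \<mu> (padic_ball n 0))"
    by (intro sum.cong refl emeasure_padic_ball_centre)
  also have "\<dots> = ennreal (real CARD('p)) * emeasure \<mu> (padic_ball n 0)"
    by (simp add: ennreal_of_nat_eq_real_of_nat)
  finally show ?thesis by (simp add: k_def)
qed

text \<open>Induction in both directions from the normalized unit ball; the downward step cancels
  the finite nonzero factor p.\<close>

lemma emeasure_padic_ball: "emeasure \<mu> (padic_ball n c) = ennreal (real CARD('p) powi n)"
proof -
  have p: "real CARD('p) > 0" using CARD_gt_1[where 'p = 'p] by simp
  have powi: "ennreal (real CARD('p) powi (i + 1)) = ennreal (real CARD('p)) * ennreal (real CARD('p) powi i)" for i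
    using p by (simp add: CARD_powi_add ennreal_mult'[symmetric] mult.commute)
  have "emeasure \<mu> (padic_ball n 0) = ennreal (real CARD('p) powi n)"
  proof (induction n rule: int_induct[where k = 0])
    case base
    have "padic_ball 0 0 = (padic_int :: 'p padic set)"
      by (auto simp: mem_padic_ball padic_int_def)
    then show ?case using haar by (simp add: padic_haar_def)
  next
    case (step1 i)
    then show ?case by (simp only: emeasure_padic_ball_step powi)
  next
    case (step2 i)
    have "ennreal (real CARD('p)) * emeasure \<mu> (padic_ball (i - 1) 0)
        = ennreal (real CARD('p)) * ennreal (real CARD('p) powi (i - 1))"
      using emeasure_padic_ball_step[of "i - 1"] powi[of "i - 1"] step2 by simp
    then show ?case using p by (simp add: ennreal_mult_cancel_left)
  qed
  then show ?thesis by (subst emeasure_padic_ball_centre)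
qed

lemma measure_padic_ball: "measure \<mu> (padic_ball n c) = real CARD('p) powi n"
  by (simp add: measure_def emeasure_padic_ball less_imp_le)

lemma integrable_indicator_padic_ball [simp]: "integrable \<mu> (indicator (padic_ball n c) :: _ \<Rightarrow> real)"
  by (rule integrable_real_indicator) (simp_all add: emeasure_padic_ball)

end

section \<open>The wavelets\<close>

lemma theta_eq:
  "theta (\<gamma>, s, a) x = of_real (real CARD('p) powr (- (real_of_int \<gamma> / 2)))
    * padic_char (s * (padic_p powi \<gamma> * x - a))
    * indicator (padic_ball \<gamma> (padic_p powi (- \<gamma>) * a)) x"
  for x :: "'p::prime_card padic"
  using theta_support_iff[of \<gamma> x a] by (simp add: theta_def Omega_def indicator_def)

text \<open>Since s has norm p^m, moving x by at most p^(\<gamma>-m) changes the argument of the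
  character by a p-adic integer, and it cannot leave or enter the support.\<close>

lemma theta_locally_constant:
  fixes x y :: "'p::prime_card padic"
  assumes "m \<ge> 1" "s \<in> J_set m" "y \<in> padic_ball (\<gamma> + - int m) x"
  shows "theta (\<gamma>, s, a) y = theta (\<gamma>, s, a) x"
proof -
  define u where "u = padic_p powi \<gamma> * x - a"
  define v where "v = padic_p powi \<gamma> * y - a"
  have "v - u = padic_p powi \<gamma> * (y - x)" by (simp add: u_def v_def right_diff_distrib)
  then have vu: "padic_norm (v - u) \<le> real CARD('p) powi (- int m)"
    using assms(3) by (simp only: padic_norm_p_powi_mult_le_iff mem_padic_ball)
  have "padic_norm (s * v - s * u) = real CARD('p) powi (int m) * padic_norm (v - u)"
    by (simp only: padic_norm_mult padic_norm_J_set[OF assms(1,2)] flip: right_diff_distrib)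
  also have "\<dots> \<le> real CARD('p) powi (int m) * real CARD('p) powi (- int m)"
    using vu by (intro mult_left_mono) auto
  also have "\<dots> = 1" by (simp flip: CARD_powi_add del: power_int_of_nat)
  finally have "padic_char (s * v) = padic_char (s * u)" by (rule padic_char_cong)
  moreover have "padic_norm (v - u) \<le> 1"
    by (rule order_trans[OF vu]) simp
  then have "padic_norm v \<le> 1 \<longleftrightarrow> padic_norm u \<le> 1"
    using padic_norm_add_le[of "v - u" 1 u] padic_norm_diff_le[of v 1 "v - u"] by auto
  ultimately show ?thesis by (simp add: theta_def Omega_def flip: u_def v_def)
qed

lemma theta_measurable:
  "m \<ge> 1 \<Longrightarrow> s \<in> J_set m \<Longrightarrow> theta (\<gamma>, s, a) \<in> borel_measurable borel"
  using theta_locally_constant by (rule padic_locally_constant_measurable)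

lemma powr_half_squared:
  "(real CARD('p::prime_card) powr (- (real_of_int \<gamma> / 2)))\<^sup>2 = real CARD('p) powi (- \<gamma>)"
proof -
  have p: "real CARD('p) > 0" using CARD_gt_1[where 'p = 'p] by simp
  have "(real CARD('p) powr (- (real_of_int \<gamma> / 2)))\<^sup>2 = real CARD('p) powr (real_of_int (- \<gamma>))"
    by (simp add: power2_eq_square flip: powr_add)
  also have "\<dots> = real CARD('p) powi (- \<gamma>)"
    by (rule powr_real_of_int') (use p in simp_all)
  finally show ?thesis .
qed

lemma cmod_theta_squared:
  "(cmod (theta (\<gamma>, s, a) x))\<^sup>2
    = real CARD('p) powi (- \<gamma>) * indicator (padic_ball \<gamma> (padic_p powi (- \<gamma>) * a)) x"
  for x :: "'p::prime_card padic"
proof -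
  have "(indicator A x :: real)\<^sup>2 = indicator A x" for A :: "'p padic set"
    by (simp add: indicator_def)
  then show ?thesis
    by (simp add: theta_eq norm_mult power_mult_distrib powr_half_squared indicator_def)
qed

section \<open>Square integrability and orthonormality of the wavelets\<close>

context padic_haar_measure
begin

lemma theta_L2:
  assumes "m \<ge> 1" "s \<in> J_set m"
  shows "theta (\<gamma>, s, a) \<in> L2 \<mu>"
proof (rule L2I)
  show "theta (\<gamma>, s, a) \<in> borel_measurable \<mu>" using theta_measurable[OF assms] by simp
  show "integrable \<mu> (\<lambda>x. real CARD('p) powi (- \<gamma>) * indicator (padic_ball \<gamma> (padic_p powi (- \<gamma>) * a)) x)"
    by (intro integrable_mult_right) simp
qed (simp add: cmod_theta_squared)

lemma padic_char_mult_measurable: "(\<lambda>x. padic_char (\<xi> * x)) \<in> borel_measurable borel"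
  for \<xi> :: "'p padic"
proof -
  obtain k where k: "padic_norm \<xi> \<le> real CARD('p) powi (int k)" by (rule padic_norm_le_powi)
  have "padic_char (\<xi> * y) = padic_char (\<xi> * x)" if "y \<in> padic_ball (- int k) x" for x y
  proof (rule padic_char_cong)
    have "padic_norm (\<xi> * y - \<xi> * x) = padic_norm \<xi> * padic_norm (y - x)"
      by (simp only: padic_norm_mult flip: right_diff_distrib)
    also have "\<dots> \<le> real CARD('p) powi (int k) * real CARD('p) powi (- int k)"
      using k that by (intro mult_mono) (auto simp: mem_padic_ball padic_norm_nonneg)
    also have "\<dots> = 1" by (simp flip: CARD_powi_add del: power_int_of_nat)
    finally show "padic_norm (\<xi> * y - \<xi> * x) \<le> 1" .
  qed
  then show ?thesis by (rule padic_locally_constant_measurable)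
qed

text \<open>Translating by a point of the ball on which the character is not 1 multiplies the integral by
  that value.\<close>

lemma integral_padic_char_ball:
  assumes \<xi>: "real CARD('p) powi (1 - n) \<le> padic_norm \<xi>"
  shows "(LINT x|\<mu>. padic_char (\<xi> * x) * indicator (padic_ball n c) x) = 0"
proof -
  define f where "f x = padic_char (\<xi> * x) * indicator (padic_ball n c) x" for x
  have pos: "0 < padic_norm \<xi>" by (rule less_le_trans[OF CARD_powi_pos \<xi>])
  then have nz: "\<xi> \<noteq> 0" by auto
  \<comment> \<open>Chosen so that \<xi> b = 1/p, where the character is not 1; the lower bound on
    the norm of \<xi> is what places b within p^n of 0, so that translation by b preserves the
    ball.\<close>
  define b where "b = padic_p powi (- 1) / \<xi>"
  have "padic_norm b = real CARD('p) powi 1 / padic_norm \<xi>"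
    by (simp add: b_def divide_inverse padic_norm_mult padic_norm_inverse padic_norm_p)
  also have "\<dots> \<le> real CARD('p) powi 1 / real CARD('p) powi (1 - n)"
    using pos \<xi> by (intro divide_left_mono mult_pos_pos) auto
  also have "\<dots> = real CARD('p) powi n"
    using CARD_gt_1[where 'p = 'p] by (simp add: power_int_diff)
  finally have b: "padic_norm b \<le> real CARD('p) powi n" .
  have "\<xi> * b = padic_p powi (- 1)" using nz by (simp add: b_def)
  then have char: "padic_char (\<xi> * b) \<noteq> 1" using padic_char_inverse_p_neq_1 by metis
  have "b + x \<in> padic_ball n c \<longleftrightarrow> x \<in> padic_ball n c" for x
    using padic_norm_add_le[OF b, of "x - c"] padic_norm_diff_le[OF _ b, of "b + x - c"]
    by (auto simp: mem_padic_ball algebra_simps)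
  then have "f (b + x) = padic_char (\<xi> * b) * f x" for x
    by (simp add: f_def distrib_left padic_char_add indicator_def)
  moreover have "f \<in> borel_measurable borel"
    unfolding f_def using padic_char_mult_measurable by (intro borel_measurable_times) auto
  ultimately have "(LINT x|\<mu>. f x) = padic_char (\<xi> * b) * (LINT x|\<mu>. f x)"
    using integral_translate[of f b] by simp
  then show ?thesis using char by (simp add: f_def)
qed

lemma L2_inner_theta_self:
  "L2_inner \<mu> (theta (\<gamma>, s, a)) (theta (\<gamma>, s, a)) = 1"
proof -
  have "L2_inner \<mu> (theta (\<gamma>, s, a)) (theta (\<gamma>, s, a))
      = (LINT x|\<mu>. of_real ((cmod (theta (\<gamma>, s, a) x))\<^sup>2))"
    by (simp add: L2_inner_def complex_norm_square del: of_real_power)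
  also have "\<dots> = of_real (real CARD('p) powi (- \<gamma>) * real CARD('p) powi \<gamma>)"
    unfolding integral_complex_of_real cmod_theta_squared by (simp add: measure_padic_ball)
  also have "\<dots> = 1" by (simp flip: CARD_powi_add)
  finally show ?thesis .
qed

text \<open>With \<gamma> \<le> \<delta> the first support is the smaller one, so it lies inside the
  second whenever they meet. The task is then to bring the frequency of the product above the
  threshold p^(1-\<gamma>) of \<open>integral_padic_char_ball\<close>.\<close>

lemma L2_inner_theta_orthogonal_le:
  assumes m: "m \<ge> 1" and s: "s \<in> J_set m" and t: "t \<in> J_set m" and a: "a \<in> I_set" and b: "b \<in> I_set"
    and neq: "(\<gamma>, s, a) \<noteq> (\<delta>, t, b)" and le: "\<gamma> \<le> \<delta>"
  shows "L2_inner \<mu> (theta (\<gamma>, s, a)) (theta (\<delta>, t, b)) = 0"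
proof -
  define A where "A = padic_ball \<gamma> (padic_p powi (- \<gamma>) * a)"
  define B where "B = padic_ball \<delta> (padic_p powi (- \<delta>) * b)"
  show ?thesis
  proof (cases "A \<inter> B = {}")
    case True
    then have "theta (\<gamma>, s, a) x * cnj (theta (\<delta>, t, b) x) = 0" for x
      by (auto simp: theta_eq indicator_def A_def B_def)
    then show ?thesis unfolding L2_inner_def by (simp only: Bochner_Integration.integral_zero)
  next
    case False
    then obtain z where z: "z \<in> A" "z \<in> B" by blast
    have "A = padic_ball \<gamma> z" using padic_ball_eq[OF z(1)[unfolded A_def]] by (simp add: A_def)
    then have AB: "A \<subseteq> B" using z(2) le padic_ball_subset by (simp add: B_def)
    define \<xi> where "\<xi> = s * padic_p powi \<gamma> - t * padic_p powi \<delta>"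
    have norm_s: "padic_norm (s * padic_p powi \<gamma>) = real CARD('p) powi (int m - \<gamma>)"
      using m s CARD_powi_add[where 'p = 'p, of "int m" "- \<gamma>"]
      by (simp add: padic_norm_mult padic_norm_J_set padic_norm_p_powi)
    have norm_t: "padic_norm (t * padic_p powi \<delta>) = real CARD('p) powi (int m - \<delta>)"
      using m t CARD_powi_add[where 'p = 'p, of "int m" "- \<delta>"]
      by (simp add: padic_norm_mult padic_norm_J_set padic_norm_p_powi)
    have \<xi>: "real CARD('p) powi (1 - \<gamma>) \<le> padic_norm \<xi>"
    proof (cases "\<gamma> = \<delta>")
      case True
      \<comment> \<open>At equal scales a common point z forces a = b, so s and t differ; being
        distinct representatives modulo Z_p, they are at distance at least p.\<close>
      have "padic_norm (padic_p powi \<gamma> * z - a) \<le> 1" "padic_norm (padic_p powi \<gamma> * z - b) \<le> 1"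
        using z True by (simp_all add: theta_support_iff A_def B_def)
      from padic_norm_diff_le[OF this(2,1)] have "a = b" by (intro I_set_unique a b) simp
      then have "s \<noteq> t" using neq True by simp
      then have "\<not> padic_norm (s - t) \<le> 1"
        using I_set_unique[of s t] J_set_subset_I_set[OF m] s t by blast
      then have "real CARD('p) powi 1 \<le> padic_norm (s - t)"
        using padic_norm_gt_powi[of 0 "s - t"] by simp
      then have "real CARD('p) powi 1 * real CARD('p) powi (- \<gamma>)
          \<le> padic_norm (s - t) * real CARD('p) powi (- \<gamma>)"
        by (intro mult_right_mono) auto
      moreover have "\<xi> = (s - t) * padic_p powi \<gamma>" using True by (simp add: \<xi>_def left_diff_distrib)
      ultimately show ?thesis
        using CARD_powi_add[where 'p = 'p, of 1 "- \<gamma>"] by (simp add: padic_norm_mult padic_norm_p_powi)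
    next
      case False
      \<comment> \<open>At different scales the term with s dominates: p^(m-\<gamma>) exceeds
        p^(m-\<delta>), and m \<ge> 1 puts it above the threshold.\<close>
      then have "padic_norm (s * padic_p powi \<gamma> - \<xi>) < padic_norm (s * padic_p powi \<gamma>)"
        using le by (simp add: \<xi>_def norm_s norm_t)
      then have "padic_norm \<xi> = real CARD('p) powi (int m - \<gamma>)"
        unfolding norm_s[symmetric] by (rule padic_norm_eqI)
      then show ?thesis using m by simp
    qed
    define K where "K = of_real (real CARD('p) powr (- (real_of_int \<gamma> / 2)) * real CARD('p) powr (- (real_of_int \<delta> / 2)))
      * padic_char (t * b - s * a)"
    have "theta (\<gamma>, s, a) x * cnj (theta (\<delta>, t, b) x) = K * (padic_char (\<xi> * x) * indicator A x)" for x
    proof (cases "x \<in> A")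
      case True
      have "padic_char (s * (padic_p powi \<gamma> * x - a)) * cnj (padic_char (t * (padic_p powi \<delta> * x - b)))
          = padic_char (s * (padic_p powi \<gamma> * x - a) + - (t * (padic_p powi \<delta> * x - b)))"
        by (simp only: padic_char_add padic_char_minus)
      also have "s * (padic_p powi \<gamma> * x - a) + - (t * (padic_p powi \<delta> * x - b)) = (t * b - s * a) + \<xi> * x"
        by (simp add: \<xi>_def algebra_simps)
      also have "padic_char \<dots> = padic_char (t * b - s * a) * padic_char (\<xi> * x)"
        by (rule padic_char_add)
      finally show ?thesis
        using True AB by (simp add: theta_eq K_def subset_iff flip: A_def B_def)
    qed (simp add: theta_eq flip: A_def)
    then have "L2_inner \<mu> (theta (\<gamma>, s, a)) (theta (\<delta>, t, b))
        = K * (LINT x|\<mu>. padic_char (\<xi> * x) * indicator A x)"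
      by (simp add: L2_inner_def)
    then show ?thesis using integral_padic_char_ball[OF \<xi>] by (simp add: A_def)
  qed
qed

text \<open>Conjugate symmetry reduces the opposite order of scales to the case already
  treated.\<close>

lemma L2_inner_commute: "L2_inner \<mu> f g = cnj (L2_inner \<mu> g f)"
  unfolding L2_inner_def by (simp add: mult.commute del: Bochner_Integration.integral_cnj flip: Bochner_Integration.integral_cnj)

lemma L2_inner_theta:
  assumes "m \<ge> 1" "i \<in> UNIV \<times> J_set m \<times> I_set" "j \<in> UNIV \<times> J_set m \<times> I_set"
  shows "L2_inner \<mu> (theta i) (theta j) = (if i = j then 1 else 0)"
proof -
  obtain \<gamma> s a \<delta> t b where ij: "i = (\<gamma>, s, a)" "j = (\<delta>, t, b)" by (metis prod_cases3)
  consider "i = j" | "i \<noteq> j" "\<gamma> \<le> \<delta>" | "i \<noteq> j" "\<delta> \<le> \<gamma>" by linarith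
  then show ?thesis
  proof cases
    case 1
    then show ?thesis by (simp add: ij L2_inner_theta_self)
  next
    case 2
    then show ?thesis using assms by (simp add: ij L2_inner_theta_orthogonal_le[of m])
  next
    case 3
    then have "L2_inner \<mu> (theta j) (theta i) = 0"
      using assms by (auto simp: ij intro!: L2_inner_theta_orthogonal_le[of m])
    then show ?thesis using 3 L2_inner_commute[of "theta i" "theta j"] by simp
  qed
qed

end

text \<open>Fourier inversion on the ball of radius \<open>p\<^sup>n\<^sup>+\<^sup>m\<close>: all characters together give the indicator
  of a ball of radius \<open>p\<^sup>n\<close>, the non-primitive ones that of a ball of radius \<open>p\<^sup>n\<^sup>+\<^sup>1\<close>.\<close>

lemma indicator_padic_ball_diff_eq_theta:
  fixes z :: "'p::prime_card padic"
  assumes "m \<ge> 1"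
  obtains F c where "finite F" "F \<subseteq> UNIV \<times> J_set m \<times> I_set"
    "\<And>x. indicator (padic_ball n z) x - indicator (padic_ball (n + 1) z) x / of_nat CARD('p)
      = (\<Sum>i\<in>F. c i * theta i x)"
proof -
  obtain l where m: "m = Suc l" using assms by (cases m) auto
  \<comment> \<open>At this scale the support D is p^m times as wide as the target ball, so
    characters of conductor p^m resolve it exactly down to radius p^n.\<close>
  define \<gamma> where "\<gamma> = n + int m"
  obtain a where a: "a \<in> I_set" "padic_norm (padic_p powi \<gamma> * z - a) \<le> 1"
    by (rule I_set_approx)
  define u where "u x = padic_p powi \<gamma> * x - a" for x
  define r where "r = complex_of_real (real CARD('p) powr (- (real_of_int \<gamma> / 2)))"
  have r: "r \<noteq> 0" using CARD_gt_1[where 'p = 'p] by (simp add: r_def)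
  define D where "D = padic_ball \<gamma> (padic_p powi (- \<gamma>) * a)"
  define F :: "(int \<times> 'p padic \<times> 'p padic) set" where "F = (\<lambda>s. (\<gamma>, s, a)) ` J_set m"
  \<comment> \<open>Fourier coefficients of a point mass at z: the phase recentres the character at
    z, r cancels the normalization of the wavelet, and p^m is the order of the group.\<close>
  define c where "c = (\<lambda>(\<gamma>' :: int, s, a' :: 'p padic). padic_char (- (s * u z)) / (r * of_nat (CARD('p) ^ m)))"
  have diff: "u x - u z = padic_p powi \<gamma> * (x - z)" for x
    by (simp add: u_def right_diff_distrib)
  have z: "z \<in> D" using a(2) by (simp add: D_def theta_support_iff)
  have sum: "(\<Sum>i\<in>F. c i * theta i x)
      = indicator D x * (\<Sum>s\<in>J_set m. padic_char (s * (u x - u z))) / of_nat (CARD('p) ^ m)" for x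
  proof -
    have "(\<Sum>i\<in>F. c i * theta i x) = (\<Sum>s\<in>J_set m. c (\<gamma>, s, a) * theta (\<gamma>, s, a) x)"
      unfolding F_def by (subst sum.reindex) (auto simp: inj_on_def)
    also have "\<dots> = (\<Sum>s\<in>J_set m. indicator D x * padic_char (s * (u x - u z)) / of_nat (CARD('p) ^ m))"
    proof (rule sum.cong[OF refl])
      fix s
      have "padic_char (s * (u x - u z)) = padic_char (s * u x + - (s * u z))"
        by (simp add: right_diff_distrib)
      then have "padic_char (s * (u x - u z)) = padic_char (s * u x) * padic_char (- (s * u z))"
        by (simp only: padic_char_add)
      then show "c (\<gamma>, s, a) * theta (\<gamma>, s, a) x
          = indicator D x * padic_char (s * (u x - u z)) / of_nat (CARD('p) ^ m)"
        using r by (simp add: c_def theta_eq flip: u_def r_def D_def)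
    qed
    also have "\<dots> = indicator D x * (\<Sum>s\<in>J_set m. padic_char (s * (u x - u z))) / of_nat (CARD('p) ^ m)"
      by (simp add: sum_distrib_left sum_divide_distrib)
    finally show ?thesis .
  qed
  have "indicator (padic_ball n z) x - indicator (padic_ball (n + 1) z) x / of_nat CARD('p)
      = (\<Sum>i\<in>F. c i * theta i x)" for x
  proof (cases "x \<in> D")
    case True
    then have "D = padic_ball \<gamma> z" "x \<in> padic_ball \<gamma> z"
      using padic_ball_eq z unfolding D_def by blast+
    then have 1: "padic_norm (u x - u z) \<le> 1"
      unfolding diff padic_norm_p_powi_mult_le_1_iff by (simp add: mem_padic_ball)
    have 2: "padic_norm (u x - u z) \<le> real CARD('p) powi (- int (Suc l)) \<longleftrightarrow> x \<in> padic_ball n z"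
      unfolding diff padic_norm_p_powi_mult_le_iff by (simp add: mem_padic_ball \<gamma>_def m)
    have 3: "padic_norm (u x - u z) \<le> real CARD('p) powi (- int l) \<longleftrightarrow> x \<in> padic_ball (n + 1) z"
      unfolding diff padic_norm_p_powi_mult_le_iff by (simp add: mem_padic_ball \<gamma>_def m add_ac)
    have "(\<Sum>i\<in>F. c i * theta i x) = ((if x \<in> padic_ball n z then of_nat (CARD('p) ^ Suc l) else 0)
        - (if x \<in> padic_ball (n + 1) z then of_nat (CARD('p) ^ l) else 0)) / of_nat (CARD('p) ^ Suc l)"
      unfolding sum m sum_padic_char_J_set[OF 1] 2 3 using True by simp
    then show ?thesis by (simp add: indicator_def diff_divide_distrib)
  next
    case False
    \<comment> \<open>Both exponents n and n + 1 are at most \<gamma> since m \<ge> 1, so outside D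
      both sides vanish.\<close>
    have "padic_ball k z \<subseteq> D" if "k \<le> \<gamma>" for k
      unfolding D_def by (rule padic_ball_subset[OF z[unfolded D_def] that])
    then have "padic_ball n z \<subseteq> D" "padic_ball (n + 1) z \<subseteq> D"
      by (simp_all add: \<gamma>_def m)
    then have "x \<notin> padic_ball n z" "x \<notin> padic_ball (n + 1) z" using False by blast+
    then show ?thesis using False by (simp add: sum)
  qed
  moreover have "finite F" "F \<subseteq> UNIV \<times> J_set m \<times> I_set"
    using finite_J_set[OF assms] a(1) by (auto simp: F_def)
  ultimately show thesis using that by blast
qed

section \<open>Completeness of the wavelet system\<close>

locale padic_wavelets = padic_haar_measure \<mu> for \<mu> :: "'p::prime_card padic measure" +
  fixes m :: nat
  assumes m: "m \<ge> 1"
begin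

sublocale L2_family \<mu> "UNIV \<times> J_set m \<times> I_set" theta
  by standard (use theta_L2[OF m] in auto)

lemma indicator_L2:
  assumes "A \<in> sets borel" "A \<subseteq> padic_ball n z"
  shows "(\<lambda>x. indicator A x) \<in> L2 \<mu>"
proof (rule L2I[OF _ integrable_indicator_padic_ball[of n z]])
  show "(cmod (indicator A x))\<^sup>2 \<le> indicator (padic_ball n z) x" for x
    using assms(2) by (auto simp: indicator_def)
qed (use assms(1) in simp)

lemma integral_indicator_padic_ball_squared:
  "(LINT x|\<mu>. (cmod (k * indicator (padic_ball n z) x))\<^sup>2) = (cmod k)\<^sup>2 * real CARD('p) powi n"
proof -
  have "(cmod (k * indicator (padic_ball n z) x))\<^sup>2 = (cmod k)\<^sup>2 * indicator (padic_ball n z) x" for x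
    by (simp add: indicator_def)
  then show ?thesis by (simp add: measure_padic_ball)
qed

lemma indicator_padic_ball_W: "(\<lambda>x. indicator (padic_ball n z) x) \<in> W"
proof (rule W_closed)
  show "(\<lambda>x. indicator (padic_ball n z) x) \<in> L2 \<mu>" by (rule indicator_L2) auto
  \<comment> \<open>The one-step identities at radii p^n, p^(n+1), ..., weighted by 1, 1/p, 1/p^2,
    ..., telescope.\<close>
  have W: "(\<lambda>x. indicator (padic_ball n z) x - indicator (padic_ball (n + int k) z) x / of_nat CARD('p) ^ k) \<in> W" for k
  proof (induction k)
    case 0
    show ?case using W_zero by simp
  next
    case (Suc k)
    obtain F c where F: "finite F" "F \<subseteq> UNIV \<times> J_set m \<times> I_set"
      "\<And>x. indicator (padic_ball (n + int k) z) x - indicator (padic_ball (n + int k + 1) z) x / of_nat CARD('p)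
        = (\<Sum>i\<in>F. c i * theta i x)"
      using indicator_padic_ball_diff_eq_theta[OF m] by blast
    have "(\<lambda>x. indicator (padic_ball (n + int k) z) x
        - indicator (padic_ball (n + int k + 1) z) x / of_nat CARD('p)) \<in> W"
      unfolding F(3) by (rule W_combination[OF F(1,2)])
    from W_add[OF Suc W_scale[OF this, of "1 / of_nat CARD('p) ^ k"]]
    show ?case by (simp add: right_diff_distrib ac_simps)
  qed
  fix e :: real assume "e > 0"
  then obtain k where k: "real CARD('p) powi (n - int k) < e" using ex_CARD_powi_less by blast
  have "(LINT x|\<mu>. (cmod (indicator (padic_ball n z) x - (indicator (padic_ball n z) x
        - indicator (padic_ball (n + int k) z) x / of_nat CARD('p) ^ k)))\<^sup>2)
      = (LINT x|\<mu>. (cmod (1 / of_nat CARD('p) ^ k * indicator (padic_ball (n + int k) z) x))\<^sup>2)"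
    by simp
  also have "\<dots> = (1 / real CARD('p) ^ k)\<^sup>2 * real CARD('p) powi (n + int k)"
    unfolding integral_indicator_padic_ball_squared by (simp add: norm_divide norm_power)
  also have "\<dots> = real CARD('p) powi (n - int k)"
    using CARD_gt_1[where 'p = 'p]
    by (simp add: power_int_add power_int_diff power2_eq_square field_simps)
  finally show "\<exists>g\<in>W. (LINT x|\<mu>. (cmod (indicator (padic_ball n z) x - g x))\<^sup>2) < e"
    using k by (intro bexI[OF _ W[of k]]) simp
qed

text \<open>The sets A with this property form a Dynkin system containing the balls. Cutting with a
  fixed ball keeps the indicators of complements square integrable and provides the dominating
  function for disjoint unions.\<close>

lemma indicator_borel_W:
  assumes "A \<in> sets borel"
  shows "(\<lambda>x. indicator (A \<inter> padic_ball R 0) x) \<in> W"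
proof -
  let ?G = "insert {} (range (\<lambda>(n, c). padic_ball n c)) :: 'p padic set set"
  have "B \<inter> C \<in> ?G" if BC: "B \<in> ?G" "C \<in> ?G" for B C
  proof (cases "B = {} \<or> C = {}")
    case False
    then obtain i a j b where "B = padic_ball i a" "C = padic_ball j b" using BC by auto
    then show ?thesis using padic_ball_Int[of i a j b] by auto
  qed auto
  then have Int: "Int_stable ?G" by (rule Int_stableI)
  moreover have "?G \<subseteq> Pow UNIV" by simp
  moreover have "A \<in> sigma_sets UNIV ?G" using assms by (simp only: sets_borel_padic)
  ultimately show ?thesis
  proof (induction rule: sigma_sets_induct_disjoint)
    case (basic A)
    then have "A \<inter> padic_ball R 0 \<in> ?G"
      by (rule Int_stableD[OF Int]) (rule insertI2, rule range_eqI[of _ _ "(R, 0)"], simp)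
    then consider "A \<inter> padic_ball R 0 = {}" | n c where "A \<inter> padic_ball R 0 = padic_ball n c"
      by auto
    then show ?case by cases (simp_all add: W_zero indicator_padic_ball_W)
  next
    case empty
    then show ?case using W_zero by simp
  next
    case (compl A)
    have "(\<lambda>x. indicator ((UNIV - A) \<inter> padic_ball R 0) x)
        = (\<lambda>x. indicator (padic_ball R 0) x - indicator (A \<inter> padic_ball R 0) x :: complex)"
      by (auto simp: indicator_def)
    then show ?case using W_diff[OF indicator_padic_ball_W compl(2)] by simp
  next
    case (union A)
    show ?case
    proof (rule W_dominated_limit)
      show "(\<lambda>x. \<Sum>i<n. indicator (A i \<inter> padic_ball R 0) x) \<in> W" for n
        by (intro W_sum union.IH)
      have "(\<lambda>x. (indicator (padic_ball R 0) x)\<^sup>2) = (indicator (padic_ball R 0) :: 'p padic \<Rightarrow> real)"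
        by (auto simp: indicator_def)
      then show "integrable \<mu> (\<lambda>x. (indicator (padic_ball R 0) x :: real)\<^sup>2)" by simp
      have sum: "(\<Sum>i<n. indicator (A i \<inter> padic_ball R 0) x) = (indicator ((\<Union>i<n. A i) \<inter> padic_ball R 0) x :: complex)" for n x
      proof -
        have "disjoint_family_on A {..<n}"
          using union(1) by (rule disjoint_family_on_mono[OF subset_UNIV])
        then have "(indicator (\<Union>i<n. A i) x :: complex) = (\<Sum>i<n. indicator (A i) x)"
          by (intro indicator_UN_disjoint) simp_all
        then show ?thesis by (simp add: indicator_inter_arith sum_distrib_right)
      qed
      show "cmod (\<Sum>i<n. indicator (A i \<inter> padic_ball R 0) x) \<le> indicator (padic_ball R 0) x" for n x
        unfolding sum by (simp add: indicator_def)
      show "(\<lambda>n. \<Sum>i<n. indicator (A i \<inter> padic_ball R 0) x)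
          \<longlonglongrightarrow> (indicator ((\<Union>i. A i) \<inter> padic_ball R 0) x :: complex)" for x
        unfolding sum unfolding indicator_inter_arith
        by (intro tendsto_mult tendsto_const LIMSEQ_indicator_UN)
    qed
  qed
qed

text \<open>Simple functions converging to f are truncated to growing balls, which makes each a
  finite combination of the indicators already treated; 2 |f| dominates them all.\<close>

lemma L2_subset_W: "L2 \<mu> \<subseteq> W"
proof
  fix f assume f: "f \<in> L2 \<mu>"
  obtain F where F: "\<And>i. simple_function \<mu> (F i)" "\<And>x. (\<lambda>i. F i x) \<longlonglongrightarrow> f x"
    "\<And>i x. cmod (F i x) \<le> 2 * cmod (f x)"
    using borel_measurable_implies_sequence_metric[OF L2_measurable[OF f], of 0] by auto
  show "f \<in> W"
  proof (rule W_dominated_limit)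
    fix i :: nat
    have "F i x * indicator (padic_ball (int i) 0) x
        = (\<Sum>y\<in>range (F i). y * indicator (F i -` {y} \<inter> padic_ball (int i) 0) x)" for x
    proof -
      have "F i x = (\<Sum>y\<in>F i ` space \<mu>. indicator (F i -` {y} \<inter> space \<mu>) x *\<^sub>R y)"
        by (rule simple_function_indicator_representation_banach[OF F(1)]) simp
      then have "F i x = (\<Sum>y\<in>range (F i). indicator (F i -` {y}) x *\<^sub>R y)"
        by (simp only: space_eq Int_UNIV_right)
      then have "F i x * indicator (padic_ball (int i) 0) x
          = (\<Sum>y\<in>range (F i). indicator (F i -` {y}) x *\<^sub>R y) * indicator (padic_ball (int i) 0) x"
        by (rule arg_cong)
      also have "\<dots> = (\<Sum>y\<in>range (F i). y * indicator (F i -` {y} \<inter> padic_ball (int i) 0) x)"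
        unfolding sum_distrib_right by (intro sum.cong refl) (simp add: indicator_def)
      finally show ?thesis .
    qed
    moreover have "F i -` {y} \<in> sets borel" for y
      using simple_functionD(2)[OF F(1), of i "{y}"] by simp
    ultimately show "(\<lambda>x. F i x * indicator (padic_ball (int i) 0) x) \<in> W"
      by (simp only:) (intro W_sum W_scale indicator_borel_W)
  next
    show "integrable \<mu> (\<lambda>x. (2 * cmod (f x))\<^sup>2)"
      using L2_integrable[OF f] by (simp add: power_mult_distrib)
    show "cmod (F i x * indicator (padic_ball (int i) 0) x) \<le> 2 * cmod (f x)" for i x
      using F(3)[of i x] by (simp add: indicator_def)
    show "(\<lambda>i. F i x * indicator (padic_ball (int i) 0) x) \<longlonglongrightarrow> f x" for x
    proof -
      obtain k where k: "padic_norm x \<le> real CARD('p) powi (int k)" by (rule padic_norm_le_powi)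
      \<comment> \<open>At a fixed x the truncation is inactive once the ball contains x, so the
        pointwise limit is unaffected.\<close>
      have "eventually (\<lambda>i. F i x * indicator (padic_ball (int i) 0) x = F i x) sequentially"
        using eventually_ge_at_top[of k]
      proof eventually_elim
        case (elim i)
        have "padic_norm x \<le> real CARD('p) powi (int i)"
          by (rule order_trans[OF k]) (use elim in \<open>simp del: power_int_of_nat\<close>)
        then show ?case by (simp add: mem_padic_ball)
      qed
      then show ?thesis by (rule tendsto_cong[THEN iffD2]) (rule F(2))
    qed
  qed
qed

lemma orthonormal_basis: "orthonormal_basis_L2 \<mu> (UNIV \<times> J_set m \<times> I_set) theta"
  unfolding orthonormal_basis_L2_def
proof (intro conjI ballI allI impI)
  fix i j :: "int \<times> 'p padic \<times> 'p padic" assume "i \<in> UNIV \<times> J_set m \<times> I_set" "j \<in> UNIV \<times> J_set m \<times> I_set"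
  then show "L2_inner \<mu> (theta i) (theta j) = (if i = j then 1 else 0)"
    by (rule L2_inner_theta[OF m])
next
  fix f and e :: real assume f: "f \<in> L2 \<mu>" and e: "e > 0"
  \<comment> \<open>The tolerance is squared because the closed span is measured by squared
    distance.\<close>
  obtain F c where F: "finite F" "F \<subseteq> UNIV \<times> J_set m \<times> I_set"
    and c: "(LINT x|\<mu>. (cmod (f x - (\<Sum>i\<in>F. c i * theta i x)))\<^sup>2) < e\<^sup>2"
    using W_approx[of f "e\<^sup>2"] f L2_subset_W e by auto
  have "L2_norm \<mu> (\<lambda>x. f x - (\<Sum>i\<in>F. c i * theta i x)) < e"
    unfolding L2_norm_def using real_sqrt_less_mono[OF c] e by simp
  then show "\<exists>F c. finite F \<and> F \<subseteq> UNIV \<times> J_set m \<times> I_set \<and>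
      L2_norm \<mu> (\<lambda>x. f x - (\<Sum>i\<in>F. c i * theta i x)) < e"
    using F by blast
qed (rule \<theta>_L2)

end

theorem theorem5p1:
  fixes m :: nat and \<mu> :: "'p::prime_card padic measure"
  assumes "m \<ge> 1" and "padic_haar \<mu>"
  shows "orthonormal_basis_L2 \<mu> (UNIV \<times> J_set m \<times> I_set) theta"
proof -
  interpret padic_wavelets \<mu> m
    by standard (rule assms)+
  show ?thesis by (rule orthonormal_basis)
qed

end
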